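(* Let $k = 2\ell$ be an even integer, let $m \ge -\ell$ and $n \ge \ell+1$ be integers, and let $a_k^{(4)}(m,n)$ denote the coefficient of $q^n$ in $f_{k,m}^{(4)}(z)$. If $n \not\equiv m \pmod 2$, then $a_k^{(4)}(m,n) = 0$.
   Context: $\Gamma_0(4) = \left\{ \begin{pmatrix} a & b \\ c & d\end{pmatrix} \in \mathrm{SL}_2(\mathbb{Z}) : c \equiv 0 \pmod 4 \right\}$, and $q = e^{2\pi i z}$ for $z$ in the upper half plane. $M_k^\sharp(4)$ is the space of weakly holomorphic modular forms of even integer weight $k$ for $\Gamma_0(4)$ (holomorphic on the upper half plane, meromorphic at the cusps) that are holomorphic away from the cusp at $\infty$, i.e. also holomorphic at the cusps $0$ and $\frac12$. For an even weight $k = 2\ell$ and an integer $m \ge -\ell$, $f_{k,m}^{(4)}$ is the unique element of $M_k^\sharp(4)$ with Fourier expansion $$f_{k,m}^{(4)}(z) = q^{-m} + \sum_{n=\ell+1}^\infty a_k^{(4)}(m,n) q^n.$$ *)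

theory Defs
  imports "HOL-Complex_Analysis.Complex_Analysis" "HOL-Number_Theory.Cong"
begin

definition upper_half_plane :: "complex set" where
  "upper_half_plane = {z. Im z > 0}"

definition SL2Z :: "(int ^ 2 ^ 2) set" where
  "SL2Z = {A. det A = 1}"

definition Gamma0_4 :: "(int ^ 2 ^ 2) set" where
  "Gamma0_4 = {A \<in> SL2Z. [A $ 2 $ 1 = 0] (mod 4)}"

definition slash :: "int \<Rightarrow> (complex \<Rightarrow> complex) \<Rightarrow> int ^ 2 ^ 2 \<Rightarrow> complex \<Rightarrow> complex" where
  "slash k f A z =
     (of_int (A $ 2 $ 1) * z + of_int (A $ 2 $ 2)) powi (- k) *
     f ((of_int (A $ 1 $ 1) * z + of_int (A $ 1 $ 2)) /
        (of_int (A $ 2 $ 1) * z + of_int (A $ 2 $ 2)))"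

definition qpar :: "complex \<Rightarrow> complex" where
  "qpar z = exp (2 * of_real pi * \<i> * z)"

text \<open>
  Cusps are the elements of the projective line over the rationals, with \<^term>\<open>None\<close>
  standing for infinity; \<^term>\<open>cusp_image A\<close> is the image of infinity under \<^term>\<open>A\<close>.
\<close>

definition cusp_image :: "int ^ 2 ^ 2 \<Rightarrow> rat option" where
  "cusp_image A =
     (if A $ 2 $ 1 = 0 then None else Some (of_int (A $ 1 $ 1) / of_int (A $ 2 $ 1)))"

text \<open>
  The behaviour of \<^term>\<open>f\<close> at a cusp \<^term>\<open>s\<close> is that of \<open>f|A\<close> near infinity, for
  \<^term>\<open>A\<close> in \<open>SL\<^sub>2(Z)\<close> mapping infinity to \<^term>\<open>s\<close>. If \<^term>\<open>f\<close> is modular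
  for \<open>\<Gamma>\<^sub>0(4)\<close>, then \<open>f|A\<close> is invariant under \<open>z \<mapsto> z + 4\<close>, because
  \<open>\<Gamma>\<^sub>0(4)\<close> contains the normal subgroup \<open>\<Gamma>(4)\<close>. So the local parameter
  \<^term>\<open>qpar (z / 4)\<close> works at every cusp; the actual width may be a proper divisor of 4,
  which does not affect meromorphy or holomorphy.
\<close>

definition meromorphic_at_cusp :: "int \<Rightarrow> (complex \<Rightarrow> complex) \<Rightarrow> rat option \<Rightarrow> bool" where
  "meromorphic_at_cusp k f s \<longleftrightarrow>
     (\<forall>A\<in>SL2Z. cusp_image A = s \<longrightarrow>
        (\<exists>g Y. g meromorphic_on {0} \<and> (\<forall>z. Im z > Y \<longrightarrow> slash k f A z = g (qpar (z / 4)))))"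

definition holomorphic_at_cusp :: "int \<Rightarrow> (complex \<Rightarrow> complex) \<Rightarrow> rat option \<Rightarrow> bool" where
  "holomorphic_at_cusp k f s \<longleftrightarrow>
     (\<forall>A\<in>SL2Z. cusp_image A = s \<longrightarrow>
        (\<exists>g Y. g analytic_on {0} \<and> (\<forall>z. Im z > Y \<longrightarrow> slash k f A z = g (qpar (z / 4)))))"

definition weakly_holomorphic_forms :: "int \<Rightarrow> (complex \<Rightarrow> complex) set" where
  "weakly_holomorphic_forms k =
     {f. f holomorphic_on upper_half_plane \<and>
         (\<forall>A\<in>Gamma0_4. \<forall>z\<in>upper_half_plane. slash k f A z = f z) \<and>
         (\<forall>s. meromorphic_at_cusp k f s)}"

text \<open>
  The cusps 0, 1/2 and infinity represent the \<open>\<Gamma>\<^sub>0(4)\<close>-orbits of cusps.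
\<close>

definition M_sharp :: "int \<Rightarrow> (complex \<Rightarrow> complex) set" where
  "M_sharp k =
     {f \<in> weakly_holomorphic_forms k.
        holomorphic_at_cusp k f (Some 0) \<and> holomorphic_at_cusp k f (Some (1 / 2))}"

text \<open>
  \<^term>\<open>is_basis_form k m f a\<close>, for even \<^term>\<open>k\<close>, characterises the element
  \<open>f = f\<^sub>k\<^sub>,\<^sub>m\<close> of \<^term>\<open>M_sharp k\<close> by its Fourier expansion
  \<open>q\<^sup>-\<^sup>m + \<Sum>\<^sub>n a(n) q\<^sup>n\<close> over \<open>n \<ge> k/2 + 1\<close>.
  The values of \<^term>\<open>f\<close> outside the upper half plane and of \<^term>\<open>a\<close> below
  \<open>k/2 + 1\<close> are irrelevant.
\<close>

definition is_basis_form ::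
    "int \<Rightarrow> int \<Rightarrow> (complex \<Rightarrow> complex) \<Rightarrow> (int \<Rightarrow> complex) \<Rightarrow> bool" where
  "is_basis_form k m f a \<longleftrightarrow>
     f \<in> M_sharp k \<and>
     (\<forall>z\<in>upper_half_plane.
        ((\<lambda>n. a n * qpar z powi n) has_sum (f z - qpar z powi (- m))) {k div 2 + 1..})"

end

(*
  Subtracting (-1)^m f(z + 1/2) from f doubles the coefficients a(n) with n - m odd and
  kills the others together with q^(-m).  Translation by 1/2 normalises Gamma_0(4), so the
  difference h is a form of weight 2l, holomorphic at the cusps 0 and 1/2, with order at least
  l + 1 at infinity.  Dividing h^2 by the l-th power of a weight 4 form Q whose only zero is a
  double zero at infinity gives an invariant function that is bounded at all cusps and vanishes
  at infinity, so h = 0 by the maximum principle.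

  One may take Q(z) = E(2z) - E(4z), where E is the Eisenstein series of weight 4.  That Q has no
  zero in the upper half plane is proved without product formulas.  The norm D of E(z) - E(2z) to
  SL_2(Z) is a cusp form of weight 12.  A maximum principle argument bounds the order at infinity
  of a level one form of weight K by K / (2 pi sqrt 3).  This suffices to show that D has a simple
  zero at infinity and that its second Rankin-Cohen bracket, of weight 28, is a multiple of D^2 E;
  comparing orders at a hypothetical zero then shows that D does not vanish.
*)

theory Submission
  imports Defs
begin

section \<open>The variable q and Fourier expansions\<close>

text \<open>The hard point is that E(z) - E(2z) has no zero in the half plane. It is a multiple of
  \<eta>(2z)^16 / \<eta>(z)^8 and its norm D a multiple of \<Delta>, but neither fact is available
  before the zeros are known. The valence formula would bound the order at infinity by K / 12. The
  analytic bound is slightly weaker, as 2 pi sqrt 3 is about 10.88, and it says nothing about zeros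
  in the interior. Only two instances are needed, and both survive the loss: 12 / 10.88 < 2 and 28 /
  10.88 < 3. The bracket makes up for the missing zero count: its proportionality to D^2 E is a
  second order differential equation for D, and this transports information from infinity to
  interior points. Weight 28 is forced by 12 + 12 + 4, and E is the form of weight 4 at
  hand.\<close>

lemma in_upper_half_plane [simp]: "z \<in> upper_half_plane \<longleftrightarrow> Im z > 0"
  by (simp add: upper_half_plane_def)

lemma open_upper_half_plane [simp, intro]: "open upper_half_plane"
  by (simp add: upper_half_plane_def open_halfspace_Im_gt)

lemma connected_upper_half_plane [simp, intro]: "connected upper_half_plane"
  by (simp add: upper_half_plane_def convex_connected convex_halfspace_Im_gt)

lemma norm_qpar: "norm (qpar z) = exp (- 2 * pi * Im z)"
  by (simp add: qpar_def)

lemma qpar_nonzero [simp]: "qpar z \<noteq> 0"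
  by (simp add: qpar_def)

lemma norm_qpar_less_1_iff: "norm (qpar z) < 1 \<longleftrightarrow> Im z > 0"
  by (simp add: norm_qpar zero_less_mult_iff)

lemma qpar_eq_iff: "qpar z = qpar w \<longleftrightarrow> (\<exists>n::int. z = w + of_int n)"
proof
  assume "qpar z = qpar w"
  then obtain n :: int where
    "2 * of_real pi * \<i> * z = 2 * of_real pi * \<i> * w + of_int (2 * n) * (of_real pi * \<i>)"
    by (auto simp: qpar_def exp_eq)
  then have "2 * of_real pi * \<i> * z = 2 * of_real pi * \<i> * (w + of_int n)"
    by (simp add: algebra_simps)
  then show "\<exists>n::int. z = w + of_int n"
    by auto
next
  assume "\<exists>n::int. z = w + of_int n"
  then obtain n :: int where n: "z = w + of_int n" ..
  show "qpar z = qpar w"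
    unfolding qpar_def exp_eq n by (intro exI[of _ n]) (simp add: algebra_simps)
qed

lemma qpar_surj:
  assumes "w \<noteq> 0"
  obtains z where "qpar z = w"
  using assms that[of "Ln w / (2 * of_real pi * \<i>)"] by (simp add: qpar_def)

lemma qpar_surj_disc:
  assumes "w \<noteq> 0" "norm w < 1"
  obtains z where "Im z > 0" "qpar z = w"
  using assms qpar_surj norm_qpar_less_1_iff by metis

lemma qpar_plus_half: "qpar (z + 1 / 2) = - qpar z"
proof -
  have "2 * of_real pi * \<i> * (z + 1 / 2) = 2 * of_real pi * \<i> * z + \<i> * of_real pi"
    by (simp add: algebra_simps)
  then show ?thesis by (simp add: qpar_def exp_add)
qed

lemma has_field_derivative_qpar [derivative_intros]:
  "(qpar has_field_derivative 2 * of_real pi * \<i> * qpar z) (at z within A)"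
  unfolding qpar_def by (auto intro!: derivative_eq_intros)

text \<open>Its basic neighbourhoods are the half planes Im z > Y, so limits are uniform in the real
  part. The conditions at the cusps have the same form.\<close>

definition at_i_infinity :: "complex filter" where
  "at_i_infinity = filtercomap Im at_top"

lemma eventually_at_i_infinity:
  "eventually P at_i_infinity \<longleftrightarrow> (\<exists>Y. \<forall>z. Im z > Y \<longrightarrow> P z)"
  unfolding at_i_infinity_def eventually_filtercomap eventually_at_top_dense by blast

lemma at_i_infinity_neq_bot [simp]: "at_i_infinity \<noteq> bot"
proof
  assume "at_i_infinity = bot"
  then have "eventually (\<lambda>_. False) at_i_infinity" by simp
  then obtain Y where "\<forall>z. Im z > Y \<longrightarrow> False" unfolding eventually_at_i_infinity by blast
  from this[rule_format, of "Complex 0 (Y + 1)"] show False by simp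
qed

lemma eventually_upper_half_plane: "eventually (\<lambda>z. Im z > 0) at_i_infinity"
  unfolding eventually_at_i_infinity by blast

lemma eventually_at_i_infinity_affine:
  assumes "eventually P at_i_infinity" "t > 0"
  shows "eventually (\<lambda>z. P (of_real t * z + b)) at_i_infinity"
proof -
  obtain Y where Y: "\<And>z. Im z > Y \<Longrightarrow> P z"
    using assms(1) unfolding eventually_at_i_infinity by blast
  have "P (of_real t * z + b)" if "Im z > (Y - Im b) / t" for z
    using that assms(2) by (intro Y) (simp add: field_simps)
  then show ?thesis unfolding eventually_at_i_infinity by blast
qed

lemma tendsto_at_i_infinity_affine:
  assumes "(f \<longlongrightarrow> c) at_i_infinity" "t > 0"
  shows "((\<lambda>z. f (of_real t * z + b)) \<longlongrightarrow> c) at_i_infinity"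
  by (rule filterlim_compose[OF assms(1)])
     (auto simp: filterlim_iff intro: eventually_at_i_infinity_affine assms(2))

lemma tendsto_qpar_0: "(qpar \<longlongrightarrow> 0) at_i_infinity"
proof -
  have "((\<lambda>z. exp (- 2 * pi * Im z)) \<longlongrightarrow> 0) at_i_infinity"
    unfolding at_i_infinity_def
    by (rule filterlim_compose[OF _ filterlim_filtercomap, where g = "\<lambda>y. exp (- 2 * pi * y)"])
       real_asymp
  then show ?thesis
    unfolding norm_qpar[symmetric] by (simp add: tendsto_norm_zero_iff)
qed

lemma tendsto_compose_qpar:
  assumes "isCont g 0"
  shows "((\<lambda>z. g (qpar z)) \<longlongrightarrow> g 0) at_i_infinity"
  using isCont_tendsto_compose[OF assms tendsto_qpar_0] .

lemma isCont_holomorphic_on: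
  assumes "g holomorphic_on A" "open A" "z \<in> A"
  shows "isCont g z"
  using holomorphic_on_imp_differentiable_at[OF assms] by (rule field_differentiable_imp_continuous_at)

lemma periodic_of_int:
  assumes per: "\<And>z. Im z > 0 \<Longrightarrow> u (z + 1) = u z" and "Im z > 0"
  shows "u (z + of_int n) = u z"
proof (induction n rule: int_induct[of _ 0])
  case (step1 i)
  have "u (z + of_int (i + 1)) = u ((z + of_int i) + 1)" by (simp add: algebra_simps)
  also have "\<dots> = u (z + of_int i)" by (rule per) (use assms(2) in simp)
  finally show ?case using step1 by simp
next
  case (step2 i)
  have "u (z + of_int i) = u ((z + of_int (i - 1)) + 1)" by (simp add: algebra_simps)
  also have "\<dots> = u (z + of_int (i - 1))" by (rule per) (use assms(2) in simp)
  finally show ?case using step2 by simp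
qed simp

text \<open>By periodicity \<open>u\<close> descends to a function of q on the punctured unit disc.
  Boundedness high up makes the singularity at 0 removable.\<close>

lemma q_expansion_ex:
  assumes holo: "u holomorphic_on upper_half_plane"
    and per: "\<And>z. Im z > 0 \<Longrightarrow> u (z + 1) = u z"
    and bdd: "\<And>z. Im z > Y \<Longrightarrow> norm (u z) \<le> B"
  obtains g where "g holomorphic_on ball 0 1" "\<And>z. Im z > 0 \<Longrightarrow> u z = g (qpar z)"
proof -
  \<comment> \<open>The principal branch jumps on the negative axis, but the branches of log q / (2
    pi i) differ by integers, which \<open>u\<close> does not see.\<close>
  define g where "g = (\<lambda>w. u (Ln w / (2 * of_real pi * \<i>)))"
  have u_eq: "u z = u w" if "qpar z = qpar w" "Im w > 0" for z w
    using that periodic_of_int[of u, OF per, of w] by (auto simp: qpar_eq_iff)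
  have g_qpar: "g (qpar z) = u z" if "Im z > 0" for z
    unfolding g_def by (rule u_eq) (use that in \<open>simp_all add: qpar_def\<close>)
  have "\<exists>A. open A \<and> w0 \<in> A \<and> g holomorphic_on A" if w0: "w0 \<noteq> 0" "norm w0 < 1" for w0
  proof -
    obtain z0 where z0: "Im z0 > 0" "qpar z0 = w0" using qpar_surj_disc[OF w0] .
    \<comment> \<open>A branch of log q / (2 pi i) centred at \<open>w0\<close>: on the set
      \<open>A\<close> below, \<open>w / w0\<close> stays within distance 1 of 1, hence off the cut
      of \<open>Ln\<close>.\<close>
    define L where "L = (\<lambda>w. Ln (w / w0) / (2 * of_real pi * \<i>) + z0)"
    have qL: "qpar (L w) = w" if "w \<noteq> 0" for w
    proof -
      have "qpar (L w) = exp (Ln (w / w0)) * qpar z0"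
        unfolding L_def qpar_def by (simp add: algebra_simps exp_add)
      then show ?thesis using that w0 z0 by simp
    qed
    define A where "A = ball w0 (norm w0) \<inter> ball 0 1"
    have Re_pos: "Re (w / w0) > 0" if "w \<in> A" for w
    proof -
      have "w / w0 - 1 = (w - w0) / w0"
        using w0 by (simp add: field_simps)
      then have "norm (w / w0 - 1) = dist w0 w / norm w0"
        by (simp only: norm_divide dist_norm norm_minus_commute)
      also have "\<dots> < 1" using that w0 by (simp add: A_def)
      finally have "norm (w / w0 - 1) < 1" .
      with abs_Re_le_cmod[of "w / w0 - 1"] show ?thesis by simp
    qed
    have nz: "w \<noteq> 0" if "w \<in> A" for w using Re_pos[OF that] by auto
    have LH: "Im (L w) > 0" if "w \<in> A" for w
      using that nz[OF that] by (subst norm_qpar_less_1_iff[symmetric]) (simp add: qL A_def)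
    have "L holomorphic_on A"
      unfolding L_def using Re_pos w0
      by (intro holomorphic_intros) (auto simp: complex_nonpos_Reals_iff not_le)
    then have "(u \<circ> L) holomorphic_on A"
      by (rule holomorphic_on_compose_gen[OF _ holo]) (use LH in auto)
    moreover have "(u \<circ> L) w = g w" if "w \<in> A" for w
      using g_qpar[OF LH[OF that]] qL[OF nz[OF that]] by simp
    ultimately have "g holomorphic_on A" by (subst (asm) holomorphic_cong[OF refl]) auto
    moreover have "open A" "w0 \<in> A" using w0 by (auto simp: A_def)
    ultimately show ?thesis by blast
  qed
  then have diff: "g field_differentiable at w" if "w \<noteq> 0" "norm w < 1" for w
    using that holomorphic_on_imp_differentiable_at by blast
  have "g holomorphic_on (ball 0 1 - {0})"
    unfolding holomorphic_on_def
  proof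
    fix w :: complex assume "w \<in> ball 0 1 - {0}"
    then show "g field_differentiable at w within ball 0 1 - {0}"
      by (auto intro: field_differentiable_at_within[OF diff])
  qed
  moreover have "eventually (\<lambda>w. norm (g w) \<le> B) (at 0)"
  proof -
    have "norm (g w) \<le> B" if w: "w \<noteq> 0" "norm w < min 1 (exp (- 2 * pi * Y))" for w
    proof -
      obtain z where z: "Im z > 0" "qpar z = w" using qpar_surj_disc[of w] w by auto
      then have "Im z > Y" using w norm_qpar[of z] by auto
      then show ?thesis using bdd g_qpar z by metis
    qed
    then show ?thesis unfolding eventually_at
      by (intro exI[of _ "min 1 (exp (- 2 * pi * Y))"]) auto
  qed
  ultimately have "\<exists>g'. g' holomorphic_on ball 0 1 \<and> (\<forall>w\<in>ball 0 1 - {0}. g' w = g w)"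
    by (subst holomorphic_on_extend_bounded) auto
  then obtain g' where g': "g' holomorphic_on ball 0 1" "\<And>w. w \<in> ball 0 1 - {0} \<Longrightarrow> g' w = g w"
    by blast
  show thesis
  proof (rule that[OF g'(1)])
    fix z assume "Im z > 0"
    then show "u z = g' (qpar z)" using g_qpar[of z] g'(2)[of "qpar z"] norm_qpar_less_1_iff[of z]
      by (auto simp: dist_norm)
  qed
qed

section \<open>Reduction theory\<close>

text \<open>The imaginary part bounds \<open>m\<close>, and the triangle inequality then bounds
  \<open>n\<close>. The constant depends continuously on \<open>z\<close>, so the estimate serves
  both the reduction and the locally uniform convergence of the Eisenstein series.\<close>

lemma cmod_lattice_ge:
  fixes m n :: int
  assumes "Im z > 0"
  shows "norm (of_int m * z + of_int n) \<ge> Im z / (1 + Im z + norm z) * (\<bar>m\<bar> + \<bar>n\<bar>)"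
proof -
  let ?N = "norm (of_int m * z + of_int n)"
  have 1: "\<bar>m\<bar> * Im z \<le> ?N"
    using abs_Im_le_cmod[of "of_int m * z + of_int n"] assms by (simp add: abs_mult)
  have "\<bar>m\<bar> * Im z * norm z \<le> ?N * norm z"
    by (rule mult_right_mono[OF 1]) simp
  moreover have "norm (of_int n :: complex) \<le> ?N + norm (of_int m * z)"
    using norm_triangle_ineq4[of "of_int m * z + of_int n" "of_int m * z"] by simp
  then have "\<bar>n\<bar> * Im z \<le> (?N + \<bar>m\<bar> * norm z) * Im z"
    using assms by (intro mult_right_mono) (simp_all add: norm_mult)
  ultimately have "(\<bar>m\<bar> + \<bar>n\<bar>) * Im z \<le> ?N * (1 + Im z + norm z)"
    using 1 by (simp add: algebra_simps)
  moreover have "1 + Im z + norm z > 0"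
    using assms norm_ge_zero[of z] by linarith
  ultimately show ?thesis
    by (simp add: field_simps)
qed

lemma finite_lattice_bounded:
  assumes "Im z > 0"
  shows "finite {(m::int, n::int). norm (of_int m * z + of_int n) < R}"
proof (rule finite_subset)
  define e where "e = Im z / (1 + Im z + norm z)"
  have e: "e > 0" unfolding e_def using assms norm_ge_zero[of z]
    by (intro divide_pos_pos) linarith+
  show "{(m::int, n::int). norm (of_int m * z + of_int n) < R} \<subseteq>
    {- \<lceil>R / e\<rceil>..\<lceil>R / e\<rceil>} \<times> {- \<lceil>R / e\<rceil>..\<lceil>R / e\<rceil>}"
  proof safe
    fix m n :: int
    assume "norm (of_int m * z + of_int n) < R"
    then have "e * (\<bar>m\<bar> + \<bar>n\<bar>) < R"
      using cmod_lattice_ge[OF assms, of m n] by (simp add: e_def)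
    then have "\<bar>m\<bar> + \<bar>n\<bar> < R / e" using e by (simp add: field_simps)
    then have "of_int (\<bar>m\<bar> + \<bar>n\<bar>) < (of_int \<lceil>R / e\<rceil> :: real)"
      using le_of_int_ceiling[of "R / e"] by linarith
    then have "\<bar>m\<bar> + \<bar>n\<bar> < \<lceil>R / e\<rceil>" by (simp only: of_int_less_iff)
    then show "m \<in> {- \<lceil>R / e\<rceil>..\<lceil>R / e\<rceil>}" "n \<in> {- \<lceil>R / e\<rceil>..\<lceil>R / e\<rceil>}" by auto
  qed
qed simp

lemma Im_uminus_inverse: "Im (- 1 / z) = Im z / (norm z)\<^sup>2"
  by (simp add: Im_divide cmod_power2)

lemma Im_uminus_inverse_pos: "Im z > 0 \<Longrightarrow> Im (- 1 / z) > 0"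
  unfolding Im_uminus_inverse by (intro divide_pos_pos zero_less_power) auto

text \<open>
  The number of lattice vectors of \<open>\<int>z + \<int>\<close> shorter than \<open>1\<close> is preserved by
  \<open>z \<mapsto> z + 1\<close> and decreases under \<open>z \<mapsto> -1/z\<close> when \<open>|z| < 1\<close>.
\<close>

lemma upper_half_plane_reduction [consumes 1, case_names high plus minus invert]:
  assumes "Im z > 0"
    and high: "\<And>z. Im z \<ge> sqrt 3 / 2 \<Longrightarrow> P z"
    and plus: "\<And>z. Im z > 0 \<Longrightarrow> P (z + 1) \<Longrightarrow> P z"
    and minus: "\<And>z. Im z > 0 \<Longrightarrow> P (z - 1) \<Longrightarrow> P z"
    and invert: "\<And>z. Im z > 0 \<Longrightarrow> P (- 1 / z) \<Longrightarrow> P z"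
  shows "P z"
proof -
  define S where "S = (\<lambda>z::complex. {(m::int, n::int). norm (of_int m * z + of_int n) < 1})"
  have shift: "P z" if "P (z + of_int k)" "Im z > 0" for z k
    using that
  proof (induction k arbitrary: z rule: int_induct[of _ 0])
    case (step1 i)
    from step1.prems show ?case
      using step1.IH[of "z + 1"] plus[of z] by (simp add: algebra_simps)
  next
    case (step2 i)
    from step2.prems show ?case
      using step2.IH[of "z - 1"] minus[of z] by (simp add: algebra_simps)
  qed simp
  show ?thesis
    using assms(1)
  proof (induction "card (S z)" arbitrary: z rule: less_induct)
    case less
    define k where "k = round (Re z)"
    define w where "w = z + of_int (- k)"
    have Im_w: "Im w > 0" and Re_w: "\<bar>Re w\<bar> \<le> 1 / 2"
      using less.prems of_int_round_abs_le[of "Re z"] by (auto simp: w_def k_def abs_minus_commute)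
    have "P w"
    proof (cases "Im w \<ge> sqrt 3 / 2")
      case False
      have "(Re w)\<^sup>2 \<le> (1 / 2)\<^sup>2"
        using Re_w by (metis abs_ge_zero power2_abs power_mono)
      moreover have "(Im w)\<^sup>2 < (sqrt 3 / 2)\<^sup>2"
        using False Im_w by (intro power_strict_mono) auto
      ultimately have "(norm w)\<^sup>2 < 1"
        by (simp add: cmod_power2 power_divide)
      then have norm_w: "norm w < 1" by (simp add: abs_square_less_1[of "norm w", simplified])
      have w0: "w \<noteq> 0" using Im_w by auto
      have inj: "inj_on (\<lambda>(m::int, n::int). (n, - m)) A" for A by (auto simp: inj_on_def)
      \<comment> \<open>Multiplication by \<open>w\<close> maps the lattice of
        \<open>- 1 / w\<close> onto that of \<open>w\<close> and scales lengths by |w|. The vector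
        (1, 0), of length |w| < 1, is missed because its preimage has length exactly 1.\<close>
      have sub: "(\<lambda>(m, n). (n, - m)) ` S (- 1 / w) \<subseteq> S w - {(1, 0)}"
      proof
        fix x assume "x \<in> (\<lambda>(m, n). (n, - m)) ` S (- 1 / w)"
        then obtain m n where x: "x = (n, - m)" and "(m, n) \<in> S (- 1 / w)" by auto
        then have *: "norm (of_int m * (- 1 / w) + of_int n) < 1" by (simp add: S_def)
        have "of_int n * w + of_int (- m) = (of_int m * (- 1 / w) + of_int n) * w"
          using w0 by (simp add: field_simps)
        then have **: "norm (of_int n * w + of_int (- m)) =
            norm (of_int m * (- 1 / w) + of_int n) * norm w"
          by (simp only: norm_mult)
        also have "\<dots> \<le> 1 * norm w" using * by (intro mult_right_mono) auto
        finally have "x \<in> S w" using norm_w by (simp add: S_def x)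
        moreover have "x \<noteq> (1, 0)" using * ** by (auto simp: x)
        ultimately show "x \<in> S w - {(1, 0)}" by simp
      qed
      have fin: "finite (S w)" unfolding S_def by (rule finite_lattice_bounded[OF Im_w])
      have "card (S (- 1 / w)) = card ((\<lambda>(m, n). (n, - m)) ` S (- 1 / w))"
        by (rule card_image[OF inj, symmetric])
      also have "\<dots> \<le> card (S w - {(1, 0)})" using fin sub by (intro card_mono) auto
      also have "\<dots> < card (S w)"
        using fin norm_w by (intro card_Diff1_less) (auto simp: S_def)
      also have "card (S w) = card (S z)"
      proof (rule bij_betw_same_card[of "\<lambda>(m, n). (m, n - m * k)"], rule bij_betwI')
        fix x y assume "x \<in> S w" "y \<in> S w"
        show "((case x of (m, n) \<Rightarrow> (m, n - m * k)) = (case y of (m, n) \<Rightarrow> (m, n - m * k))) = (x = y)"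
          by (auto split: prod.splits)
      next
        fix x assume "x \<in> S w"
        then show "(case x of (m, n) \<Rightarrow> (m, n - m * k)) \<in> S z"
          by (auto simp: S_def w_def algebra_simps)
      next
        fix y assume "y \<in> S z"
        then show "\<exists>x\<in>S w. y = (case x of (m, n) \<Rightarrow> (m, n - m * k))"
          by (intro bexI[of _ "(fst y, snd y + fst y * k)"])
             (auto simp: S_def w_def algebra_simps)
      qed
      finally show ?thesis
        using less.hyps[of "- 1 / w"] invert[of w] Im_uminus_inverse_pos[OF Im_w] Im_w by blast
    qed (rule high)
    then show "P z" using shift[of z "- k"] less.prems by (simp add: w_def)
  qed
qed

text \<open>With x = t/s the claim comes from the k-th power of x < exp (x - 1): beyond y = s the
  function y^k exp (-ky/s) stays below its value at s.\<close>

lemma power_exp_less_at_max: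
  fixes s t :: real
  assumes "0 < s" "s < t" "k > 0"
  shows "t ^ k * exp (- (real k * t / s)) < s ^ k * exp (- real k)"
proof -
  have "t / s < exp (t / s - 1)"
    using exp_minus_greater[of "1 - t / s"] assms by simp
  then have "(t / s) ^ k < exp (t / s - 1) ^ k"
    using assms by (intro power_strict_mono) auto
  also have "\<dots> = exp (real k * t / s) * exp (- real k)"
    by (simp add: exp_of_nat_mult[symmetric] exp_add[symmetric] algebra_simps)
  finally show ?thesis
    using assms by (simp add: power_divide exp_minus field_simps)
qed

section \<open>Growth of level one forms\<close>

lemma tendsto_power_exp_i_infinity:
  assumes "M > 0"
  shows "((\<lambda>z. Im z ^ k * norm (qpar z ^ M)) \<longlongrightarrow> 0) at_i_infinity"
proof -
  have "((\<lambda>y::real. (2 * pi * M * y) ^ k / exp (2 * pi * M * y)) \<longlongrightarrow> 0) at_top"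
    by (rule filterlim_compose[OF tendsto_power_div_exp_0]) (use assms in real_asymp)
  then have "((\<lambda>y::real. 1 / (2 * pi * M) ^ k * ((2 * pi * M * y) ^ k / exp (2 * pi * M * y))) \<longlongrightarrow> 0) at_top"
    by (rule tendsto_mult_right_zero)
  also have "(\<lambda>y. 1 / (2 * pi * M) ^ k * ((2 * pi * M * y) ^ k / exp (2 * pi * M * y))) =
      (\<lambda>y. y ^ k * exp (- 2 * pi * M * y))"
    using assms by (simp add: fun_eq_iff power_mult_distrib exp_minus field_simps)
  finally have "((\<lambda>z. Im z ^ k * exp (- 2 * pi * M * Im z)) \<longlongrightarrow> 0) at_i_infinity"
    unfolding at_i_infinity_def by (rule filterlim_compose) (rule filterlim_filtercomap)
  also have "(\<lambda>z. Im z ^ k * exp (- 2 * pi * M * Im z)) = (\<lambda>z. Im z ^ k * norm (qpar z ^ M))"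
    by (simp add: fun_eq_iff norm_power norm_qpar exp_of_nat_mult[symmetric] mult_ac)
  finally show ?thesis .
qed

text \<open>
  Let \<open>y\<^sup>k |f|\<close> be maximal at \<open>z\<^sub>0\<close>, where one may take \<open>Im z\<^sub>0 \<ge> \<surd>3/2\<close>. Comparing \<open>f/q\<^sup>M\<close> at
  \<open>z\<^sub>0\<close> with its values on the horizontal line at height \<open>s = k/(2\<pi>M)\<close>, where
  \<open>y\<^sup>k e\<^sup>-\<^sup>2\<^sup>\<pi>\<^sup>M\<^sup>y\<close> is largest, contradicts the maximum principle when \<open>s < \<surd>3/2\<close>.
\<close>

lemma level_one_eq_0:
  assumes holo: "f holomorphic_on upper_half_plane"
    and per: "\<And>z. Im z > 0 \<Longrightarrow> f (z + 1) = f z"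
    and inv: "\<And>z. Im z > 0 \<Longrightarrow> f (- 1 / z) = z ^ (2 * k) * f z"
    and g: "g holomorphic_on ball 0 1" "\<And>z. Im z > 0 \<Longrightarrow> f z = qpar z ^ M * g (qpar z)"
    and k: "k > 0" "real k < sqrt 3 * pi * real M"
    and "Im z > 0"
  shows "f z = 0"
proof (rule ccontr)
  assume nz: "f z \<noteq> 0"
  \<comment> \<open>The factor |z|^(2k) from \<open>inv\<close> is compensated by Im (-1/z) = Im z /
    |z|^2, so \<open>\<phi>\<close> is invariant under the modular group.\<close>
  define \<phi> where "\<phi> = (\<lambda>z. Im z ^ k * norm (f z))"
  define t where "t = sqrt 3 / 2"
  have t: "t > 0" by (simp add: t_def)
  have M: "M > 0" using k by (cases M) auto
  have \<phi>_plus: "\<phi> (z + 1) = \<phi> z" if "Im z > 0" for z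
    using that by (simp add: \<phi>_def per)
  have \<phi>_inv: "\<phi> (- 1 / z) = \<phi> z" if "Im z > 0" for z
  proof -
    have "\<phi> (- 1 / z) = (Im z / (norm z)\<^sup>2) ^ k * (norm z ^ (2 * k) * norm (f z))"
      unfolding \<phi>_def inv[OF that] Im_uminus_inverse by (simp add: norm_mult norm_power)
    then show ?thesis using that by (auto simp: \<phi>_def power_divide power_mult)
  qed
  have \<phi>_ub: "\<phi> z \<le> B" if "Im z > 0" and B: "\<And>z. Im z \<ge> t \<Longrightarrow> \<phi> z \<le> B" for z B
    using \<open>Im z > 0\<close>
  proof (induction z rule: upper_half_plane_reduction)
    case (high z)
    then show ?case by (intro B) (simp add: t_def)
  next
    case (plus z)
    then show ?case by (simp only: \<phi>_plus)
  next
    case (minus z)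
    moreover have "\<phi> z = \<phi> (z - 1)" using \<phi>_plus[of "z - 1"] minus(1) by simp
    ultimately show ?case by (simp only:)
  next
    case (invert z)
    then show ?case by (simp only: \<phi>_inv)
  qed
  have "\<exists>z1. Im z1 \<ge> t \<and> f z1 \<noteq> 0"
  proof (rule ccontr)
    assume "\<not> ?thesis"
    then have "\<phi> w \<le> 0" if "Im w \<ge> t" for w using that by (auto simp: \<phi>_def)
    then have "\<phi> z \<le> 0" by (rule \<phi>_ub[OF assms(8)])
    moreover have "\<phi> z > 0" using nz assms(8) by (simp add: \<phi>_def)
    ultimately show False by simp
  qed
  then obtain z1 where z1: "Im z1 \<ge> t" "f z1 \<noteq> 0" by blast
  have \<phi>_z1: "\<phi> z1 > 0" using z1 t by (simp add: \<phi>_def)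
  have "isCont g 0" by (rule isCont_holomorphic_on[OF g(1)]) auto
  from tendsto_mult[OF tendsto_power_exp_i_infinity[OF M, of k] tendsto_norm[OF tendsto_compose_qpar[OF this]]]
  have "((\<lambda>z. Im z ^ k * norm (qpar z ^ M) * norm (g (qpar z))) \<longlongrightarrow> 0) at_i_infinity"
    by simp
  then have "eventually (\<lambda>z. Im z ^ k * norm (qpar z ^ M) * norm (g (qpar z)) < \<phi> z1) at_i_infinity"
    by (rule order_tendstoD) (rule \<phi>_z1)
  with eventually_upper_half_plane have "eventually (\<lambda>z. \<phi> z < \<phi> z1) at_i_infinity"
    by eventually_elim (simp add: \<phi>_def g(2) norm_mult mult_ac)
  then obtain Y where Y: "\<And>z. Im z > Y \<Longrightarrow> \<phi> z < \<phi> z1" unfolding eventually_at_i_infinity by blast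
  have Im_z1: "Im z1 \<le> Y" using Y[of z1] by force
  \<comment> \<open>Above height \<open>Y\<close> the function is smaller than
    \<open>\<phi> z1\<close>, and translations bring the real part into [0, 1]. The maximum over
    this compact box is therefore global.\<close>
  define box where "box = cbox (Complex 0 t) (Complex 1 Y)"
  have in_box: "\<exists>w\<in>box. \<phi> w = \<phi> z" if "Im z \<ge> t" "Im z \<le> Y" for z
  proof
    show "z + of_int (- \<lfloor>Re z\<rfloor>) \<in> box"
      using that by (simp add: box_def in_cbox_complex_iff) linarith
    show "\<phi> (z + of_int (- \<lfloor>Re z\<rfloor>)) = \<phi> z"
      using that t by (intro periodic_of_int \<phi>_plus) auto
  qed
  have "continuous_on box \<phi>"
    unfolding \<phi>_def
  proof (intro continuous_intros)
    show "continuous_on box f"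
      by (rule continuous_on_subset[OF holomorphic_on_imp_continuous_on[OF holo]])
         (use t in \<open>auto simp: box_def in_cbox_complex_iff\<close>)
  qed
  moreover have "compact box" "box \<noteq> {}" using in_box[OF z1(1) Im_z1] by (auto simp: box_def)
  ultimately obtain z0 where z0: "z0 \<in> box" "\<And>w. w \<in> box \<Longrightarrow> \<phi> w \<le> \<phi> z0"
    using continuous_attains_sup by metis
  have Im_z0: "Im z0 \<ge> t" using z0(1) by (simp add: box_def in_cbox_complex_iff)
  have \<phi>_le_box: "\<phi> z \<le> \<phi> z0" if "Im z \<ge> t" "Im z \<le> Y" for z
    using in_box[OF that] z0(2) by metis
  have pos: "\<phi> z0 > 0" using \<phi>_le_box[OF z1(1) Im_z1] \<phi>_z1 by linarith
  have \<phi>_le: "\<phi> z \<le> \<phi> z0" if "Im z > 0" for z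
  proof (rule \<phi>_ub[OF that])
    fix z assume "Im z \<ge> t"
    then show "\<phi> z \<le> \<phi> z0"
      using \<phi>_le_box[of z] Y[of z] \<phi>_le_box[OF z1(1) Im_z1] by (cases "Im z \<le> Y") auto
  qed
  define s where "s = real k / (2 * pi * real M)"
  have s: "s > 0" using k M by (simp add: s_def)
  have s_eq: "2 * pi * real M = real k / s" using k M by (simp add: s_def)
  \<comment> \<open>This is exactly the hypothesis relating \<open>k\<close> and \<open>M\<close>:
    the peak of y^k exp (-2 pi M y) lies below the height \<open>t\<close> reached by the
    reduction.\<close>
  have "s < t" unfolding s_def t_def using k(2) M by (simp add: field_simps)
  then have s_less: "s < Im z0" using Im_z0 by simp
  define r where "r = exp (- 2 * pi * s)"
  have r: "r < 1" "r > 0" using s by (auto simp: r_def)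
  have f_eq: "norm (f z) = exp (- (real k * Im z / s)) * norm (g (qpar z))" if "Im z > 0" for z
  proof -
    have "norm (qpar z ^ M) = exp (- (2 * pi * real M) * Im z)"
      by (simp add: norm_power norm_qpar exp_of_nat_mult[symmetric] mult_ac)
    then show ?thesis unfolding g(2)[OF that] norm_mult s_eq by simp
  qed
  \<comment> \<open>The bound for |g| on the circle |q| = \<open>r\<close>, obtained from
    \<open>\<phi> z \<le> \<phi> z0\<close> at height \<open>s\<close>.\<close>
  define C where "C = \<phi> z0 / s ^ k * exp (real k)"
  have "norm (g (qpar z0)) \<le> C"
  proof (rule maximum_modulus_frontier[of g "cball 0 r"])
    show "g holomorphic_on interior (cball 0 r)"
      by (rule holomorphic_on_subset[OF g(1)]) (use r in auto)
    show "continuous_on (closure (cball 0 r)) g"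
      by (rule continuous_on_subset[OF holomorphic_on_imp_continuous_on[OF g(1)]]) (use r in auto)
    show "qpar z0 \<in> cball 0 r"
      using s_less by (simp add: norm_qpar r_def)
    fix w :: complex assume "w \<in> frontier (cball 0 r)"
    then have w: "norm w = r" using r by simp
    then have "w \<noteq> 0" "norm w < 1" using r by auto
    then obtain z where z: "Im z > 0" "qpar z = w" by (rule qpar_surj_disc)
    have Im_z: "Im z = s" using w norm_qpar[of z] by (simp add: z(2) r_def)
    have "\<phi> z = s ^ k * exp (- real k) * norm (g w)"
      using s by (simp add: \<phi>_def f_eq[OF z(1)] z(2) Im_z)
    then have "s ^ k * exp (- real k) * norm (g w) \<le> \<phi> z0" using \<phi>_le[OF z(1)] by simp
    then show "norm (g w) \<le> C"
      using s by (simp add: C_def exp_minus field_simps)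
  qed simp
  have "Im z0 > 0" using Im_z0 t by simp
  then have "\<phi> z0 = (Im z0 ^ k * exp (- (real k * Im z0 / s))) * norm (g (qpar z0))"
    by (simp add: \<phi>_def f_eq)
  also have "\<dots> \<le> (Im z0 ^ k * exp (- (real k * Im z0 / s))) * C"
    by (intro mult_left_mono) (use \<open>norm (g (qpar z0)) \<le> C\<close> \<open>Im z0 > 0\<close> in auto)
  also have "\<dots> < (s ^ k * exp (- real k)) * C"
    using pos s by (intro mult_strict_right_mono power_exp_less_at_max s s_less k) (auto simp: C_def)
  also have "\<dots> = \<phi> z0"
    using s by (simp add: C_def exp_minus field_simps)
  finally show False by simp
qed

section \<open>The Eisenstein series of weight 4\<close>

text \<open>A product of one-variable majorants, so that summation over pairs splits. Up to the
  factor 16 it dominates (|m| + |n|)^(-4) away from the origin.\<close>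

definition lattice_majorant :: "int \<times> int \<Rightarrow> real" where
  "lattice_majorant = (\<lambda>(m, n). 1 / (1 + \<bar>real_of_int m\<bar>)\<^sup>2 * (1 / (1 + \<bar>real_of_int n\<bar>)\<^sup>2))"

lemma summable_int_inverse_square: "(\<lambda>n::int. 1 / (1 + \<bar>real_of_int n\<bar>)\<^sup>2) summable_on UNIV"
proof -
  have "summable (\<lambda>n. inverse (real (Suc n) ^ 2))"
    using inverse_power_summable[of 2, where 'a = real] by (subst summable_Suc_iff) auto
  then have nat: "(\<lambda>n::nat. 1 / (1 + real n)\<^sup>2) summable_on UNIV"
    by (intro norm_summable_imp_summable_on) (simp add: field_simps)
  have "(\<lambda>n::int. 1 / (1 + \<bar>real_of_int n\<bar>)\<^sup>2) summable_on range int"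
    by (subst summable_on_reindex) (use nat in \<open>auto simp: o_def\<close>)
  moreover have "(\<lambda>n::int. 1 / (1 + \<bar>real_of_int n\<bar>)\<^sup>2) summable_on range (\<lambda>n. - int n)"
    by (subst summable_on_reindex) (use nat in \<open>auto simp: o_def inj_on_def\<close>)
  ultimately have "(\<lambda>n::int. 1 / (1 + \<bar>real_of_int n\<bar>)\<^sup>2) summable_on (range int \<union> range (\<lambda>n. - int n))"
    by (rule summable_on_union)
  moreover have "range int \<union> range (\<lambda>n. - int n) = UNIV"
    by (auto intro: int_cases2)
  ultimately show ?thesis by simp
qed

lemma summable_lattice_majorant: "lattice_majorant summable_on UNIV"
proof -
  let ?u = "\<lambda>n::int. 1 / (1 + \<bar>real_of_int n\<bar>)\<^sup>2"
  have "lattice_majorant summable_on Sigma UNIV (\<lambda>_. UNIV)"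
  proof (rule summable_on_SigmaI)
    show "((\<lambda>n. lattice_majorant (m, n)) has_sum ?u m * (\<Sum>\<^sub>\<infinity>n. ?u n)) UNIV" for m
      unfolding lattice_majorant_def prod.case
      by (intro has_sum_cmult_right has_sum_infsum summable_int_inverse_square)
    show "(\<lambda>m. ?u m * (\<Sum>\<^sub>\<infinity>n. ?u n)) summable_on UNIV"
      by (intro summable_on_cmult_left summable_int_inverse_square)
  qed (simp add: lattice_majorant_def)
  then show ?thesis by simp
qed

definition eis_term :: "complex \<Rightarrow> int \<times> int \<Rightarrow> complex" where
  "eis_term z = (\<lambda>(m, n). inverse ((of_int m * z + of_int n) ^ 4))"

text \<open>The term \<open>(0, 0)\<close> contributes \<open>inverse 0 = 0\<close>.\<close>

definition eis :: "complex \<Rightarrow> complex" where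
  "eis z = (\<Sum>\<^sub>\<infinity>x. eis_term z x)"

text \<open>\<open>\<delta>\<close> need only lie below the ratio in \<open>cmod_lattice_ge\<close>,
  so that a single value works on a whole region. The 16 comes from 1 + s <= 2s for s = |m| + |n| >=
  1.\<close>

lemma norm_eis_term_le:
  assumes \<delta>: "\<delta> > 0" "Im z > 0" "\<delta> * (1 + Im z + norm z) \<le> Im z"
  shows "norm (eis_term z x) \<le> 16 / \<delta> ^ 4 * lattice_majorant x"
proof -
  obtain m n where x: "x = (m, n)" by force
  define s where "s = \<bar>real_of_int m\<bar> + \<bar>real_of_int n\<bar>"
  let ?N = "norm (of_int m * z + of_int n)"
  let ?p = "(1 + \<bar>real_of_int m\<bar>) * (1 + \<bar>real_of_int n\<bar>)"
  show ?thesis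
  proof (cases "m = 0 \<and> n = 0")
    case True
    then show ?thesis using \<delta> by (simp add: x eis_term_def lattice_majorant_def)
  next
    case False
    then have s: "s \<ge> 1" unfolding s_def by linarith
    have "1 + Im z + norm z > 0" using \<delta>(2) norm_ge_zero[of z] by linarith
    then have "\<delta> \<le> Im z / (1 + Im z + norm z)"
      using \<delta> by (simp add: field_simps)
    then have "\<delta> * s \<le> Im z / (1 + Im z + norm z) * s"
      using s by (intro mult_right_mono) auto
    also have "\<dots> \<le> ?N" using cmod_lattice_ge[OF \<delta>(2), of m n] by (simp add: s_def)
    finally have N: "\<delta> * s \<le> ?N" .
    have "?p \<le> (1 + s) * (1 + s)" unfolding s_def by (intro mult_mono) auto
    also have "\<dots> \<le> (2 * s) * (2 * s)" using s by (intro mult_mono) auto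
    finally have "?p\<^sup>2 \<le> ((2 * s) * (2 * s))\<^sup>2" by (intro power_mono) auto
    also have "\<dots> = 16 * s ^ 4" by (simp add: power_mult_distrib power2_eq_square power4_eq_xxxx)
    finally have "\<delta> ^ 4 * ?p\<^sup>2 \<le> 16 * (\<delta> * s) ^ 4"
      using \<delta> by (simp add: power_mult_distrib mult_left_mono)
    also have "\<dots> \<le> 16 * ?N ^ 4" using N s \<delta> by (intro mult_left_mono power_mono) auto
    finally have *: "\<delta> ^ 4 * ?p\<^sup>2 \<le> 16 * ?N ^ 4" .
    have "0 < \<delta> * s" using \<delta> s by simp
    then have "?N > 0" using N by linarith
    have "norm (eis_term z x) = 1 / ?N ^ 4"
      by (simp add: x eis_term_def norm_inverse norm_power divide_inverse)
    also have "\<dots> \<le> 16 / (\<delta> ^ 4 * ?p\<^sup>2)"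
      using * \<open>?N > 0\<close> \<delta> by (simp add: divide_simps mult.commute split: if_splits)
    also have "\<dots> = 16 / \<delta> ^ 4 * lattice_majorant x"
      by (simp add: x lattice_majorant_def power_mult_distrib)
    finally show ?thesis .
  qed
qed

lemma eis_has_sum:
  assumes "Im z > 0"
  shows "(eis_term z has_sum eis z) UNIV"
proof -
  define \<delta> where "\<delta> = Im z / (1 + Im z + norm z)"
  have *: "1 + Im z + norm z > 0" using assms norm_ge_zero[of z] by linarith
  have "eis_term z summable_on UNIV"
  proof (rule abs_summable_summable, rule summable_on_comparison_test)
    show "(\<lambda>x. 16 / \<delta> ^ 4 * lattice_majorant x) summable_on UNIV"
      by (intro summable_on_cmult_right summable_lattice_majorant)
    show "norm (eis_term z x) \<le> 16 / \<delta> ^ 4 * lattice_majorant x" for x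
      using assms * by (intro norm_eis_term_le) (auto simp: \<delta>_def)
  qed auto
  then show ?thesis unfolding eis_def by (rule has_sum_infsum)
qed

lemma norm_eis_le:
  assumes "\<delta> > 0" "Im z > 0" "\<delta> * (1 + Im z + norm z) \<le> Im z"
  shows "norm (eis z) \<le> 16 / \<delta> ^ 4 * (\<Sum>\<^sub>\<infinity>x. lattice_majorant x)"
proof (rule norm_infsum_le[OF eis_has_sum])
  show "((\<lambda>x. 16 / \<delta> ^ 4 * lattice_majorant x) has_sum 16 / \<delta> ^ 4 * (\<Sum>\<^sub>\<infinity>x. lattice_majorant x)) UNIV"
    by (intro has_sum_cmult_right has_sum_infsum summable_lattice_majorant)
qed (use assms norm_eis_term_le in auto)

lemma moebius_denominator_nonzero:
  fixes a b c d :: int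
  assumes "a * d - b * c = 1" "Im z > 0"
  shows "of_int c * z + of_int d \<noteq> 0"
proof
  assume *: "of_int c * z + of_int d = 0"
  then have "Im (of_int c * z + of_int d) = 0" by simp
  then have "c = 0" using assms(2) by simp
  with * assms(1) show False by simp
qed

text \<open>Clearing the denominator replaces the row vector (m, n) by its product with the matrix.
  Determinant 1 makes this a bijection of the index set, and an unordered sum is unaffected by
  reindexing.\<close>

lemma eis_moebius:
  fixes a b c d :: int
  assumes det: "a * d - b * c = 1" and "Im z > 0"
  shows "eis ((of_int a * z + of_int b) / (of_int c * z + of_int d)) =
    (of_int c * z + of_int d) ^ 4 * eis z"
proof -
  define j where "j = of_int c * z + of_int d"
  define \<sigma> where "\<sigma> = (\<lambda>(m, n). (m * a + n * c, m * b + n * d))"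
  define \<tau> where "\<tau> = (\<lambda>(m, n). (m * d - n * c, n * a - m * b))"
  have j: "j \<noteq> 0" unfolding j_def by (rule moebius_denominator_nonzero[OF assms])
  have *: "m * (a * d) - m * (b * c) = m" for m
    using det by (simp add: right_diff_distrib[symmetric])
  have \<sigma>: "bij \<sigma>"
  proof (rule o_bij)
    show "\<tau> \<circ> \<sigma> = id" "\<sigma> \<circ> \<tau> = id"
      using * by (auto simp: fun_eq_iff \<sigma>_def \<tau>_def algebra_simps)
  qed
  have "eis_term ((of_int a * z + of_int b) / j) x = j ^ 4 * eis_term z (\<sigma> x)" for x
  proof -
    obtain m n where x: "x = (m, n)" by force
    have "of_int m * ((of_int a * z + of_int b) / j) + of_int n =
        (of_int (m * a + n * c) * z + of_int (m * b + n * d)) / j"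
      using j by (simp add: field_simps j_def)
    then show ?thesis
      by (simp only: x eis_term_def \<sigma>_def prod.case power_divide) (simp add: divide_inverse)
  qed
  then have "eis ((of_int a * z + of_int b) / j) = j ^ 4 * (\<Sum>\<^sub>\<infinity>x. eis_term z (\<sigma> x))"
    by (simp add: eis_def infsum_cmult_right')
  also have "(\<Sum>\<^sub>\<infinity>x. eis_term z (\<sigma> x)) = eis z"
    unfolding eis_def by (rule infsum_reindex_bij_betw[OF \<sigma>])
  finally show ?thesis by (simp add: j_def)
qed

lemma eis_plus_of_int: "Im z > 0 \<Longrightarrow> eis (z + of_int n) = eis z"
  using eis_moebius[of 1 1 n 0 z] by simp

lemma eis_plus_1: "Im z > 0 \<Longrightarrow> eis (z + 1) = eis z"
  using eis_plus_of_int[of z 1] by simp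

lemma eis_uminus_inverse: "Im z > 0 \<Longrightarrow> eis (- 1 / z) = z ^ 4 * eis z"
  using eis_moebius[of 0 0 "- 1" 1 z] by simp

lemma holomorphic_eis: "eis holomorphic_on upper_half_plane"
proof -
  have "eis field_differentiable at z0" if z0: "Im z0 > 0" for z0
  proof -
    define r where "r = Im z0 / 2"
    have r: "r > 0" using z0 by (simp add: r_def)
    \<comment> \<open>On the ball Im z lies between \<open>r\<close> and 3 \<open>r\<close>, and |z|
      <= |z0| + \<open>r\<close>; \<open>R\<close> is the resulting bound for 1 + Im z +
      |z|.\<close>
    define R where "R = 1 + 4 * r + norm z0"
    have R: "R > 0" unfolding R_def using r norm_ge_zero[of z0] by linarith
    define \<delta> where "\<delta> = r / R"
    have \<delta>: "\<delta> > 0" using r R by (simp add: \<delta>_def)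
    have ball: "Im z > 0 \<and> \<delta> * (1 + Im z + norm z) \<le> Im z" if "z \<in> cball z0 r" for z
    proof -
      have d: "norm (z - z0) \<le> r" using that by (simp add: dist_norm norm_minus_commute)
      have "\<bar>Im z - Im z0\<bar> \<le> r" using abs_Im_le_cmod[of "z - z0"] d by simp
      moreover have "Im z0 = 2 * r" by (simp add: r_def)
      ultimately have Im_z: "Im z \<ge> r" "Im z \<le> 3 * r" by linarith+
      have "norm z \<le> norm z0 + r" using d norm_triangle_sub[of z z0] by linarith
      then have "\<delta> * (1 + Im z + norm z) \<le> \<delta> * R"
        using Im_z \<delta> by (intro mult_left_mono) (auto simp: R_def)
      also have "\<dots> = r" using R by (simp add: \<delta>_def)
      finally show ?thesis using Im_z r by linarith
    qed
    have lim: "uniform_limit (cball z0 r) (\<lambda>X z. \<Sum>x\<in>X. eis_term z x) eis (finite_subsets_at_top UNIV)"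
    proof (rule Weierstrass_m_test_general')
      show "norm (eis_term z x) \<le> 16 / \<delta> ^ 4 * lattice_majorant x" if "z \<in> cball z0 r" for x z
        using ball[OF that] \<delta> by (intro norm_eis_term_le) auto
      show "(eis_term z has_sum eis z) UNIV" if "z \<in> cball z0 r" for z
        using ball[OF that] by (intro eis_has_sum) auto
      show "(\<lambda>x. 16 / \<delta> ^ 4 * lattice_majorant x) summable_on UNIV"
        by (intro summable_on_cmult_right summable_lattice_majorant)
    qed
    have "(\<lambda>z. eis_term z x) holomorphic_on cball z0 r" for x
    proof (cases "x = (0, 0)")
      case True then show ?thesis by (simp add: eis_term_def)
    next
      case False
      obtain m n where x: "x = (m, n)" by force
      have "of_int m * z + of_int n \<noteq> 0" if "z \<in> cball z0 r" for z
      proof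
        assume *: "of_int m * z + of_int n = 0"
        then have "Im (of_int m * z + of_int n) = 0" by simp
        then have "m = 0" using ball[OF that] by simp
        with * False x show False by simp
      qed
      then show ?thesis unfolding x eis_term_def prod.case by (intro holomorphic_intros) auto
    qed
    then have term_sum: "(\<lambda>z. \<Sum>x\<in>X. eis_term z x) holomorphic_on cball z0 r" for X
      by (intro holomorphic_on_sum)
    have "eventually (\<lambda>X. continuous_on (cball z0 r) (\<lambda>z. \<Sum>x\<in>X. eis_term z x) \<and>
        (\<lambda>z. \<Sum>x\<in>X. eis_term z x) holomorphic_on ball z0 r) (finite_subsets_at_top UNIV)"
      using holomorphic_on_imp_continuous_on[OF term_sum] holomorphic_on_subset[OF term_sum ball_subset_cball]
      by (intro always_eventually) blast
    from holomorphic_uniform_limit[OF this lim] have "eis holomorphic_on ball z0 r" by simp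
    then show ?thesis by (rule holomorphic_on_imp_differentiable_at) (use r in auto)
  qed
  then show ?thesis
    unfolding holomorphic_on_def by (auto intro: field_differentiable_at_within)
qed

lemma bounded_eis:
  obtains B where "\<And>z. Im z > 1 \<Longrightarrow> norm (eis z) \<le> B"
proof
  fix z :: complex assume z: "Im z > 1"
  define w where "w = z + of_int (- \<lfloor>Re z\<rfloor>)"
  have Re: "0 \<le> Re w" "Re w \<le> 1" and Im: "Im w = Im z" unfolding w_def by (simp_all, linarith)
  have "norm w \<le> 1 + Im w" using cmod_le[of w] Re Im z by linarith
  \<comment> \<open>The value 1/4 for \<open>\<delta>\<close> is admissible since 1 + Im w + |w| <=
    2 + 2 Im w < 4 Im w.\<close>
  then have "norm (eis w) \<le> 16 / (1 / 4) ^ 4 * (\<Sum>\<^sub>\<infinity>x. lattice_majorant x)"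
    by (intro norm_eis_le) (use Im z in auto)
  then show "norm (eis z) \<le> 16 / (1 / 4) ^ 4 * (\<Sum>\<^sub>\<infinity>x. lattice_majorant x)"
    using z eis_plus_of_int[of z "- \<lfloor>Re z\<rfloor>"] by (simp only: w_def)
qed

text \<open>The terms with \<open>m = 0\<close> are nonnegative, (0, 1) contributes 1, and all
  others together are O(1/y^2). This shows that the constant term is nonzero without evaluating
  it.\<close>

lemma Re_eis_imaginary_axis:
  assumes y: "y \<ge> 1"
  shows "Re (eis (Complex 0 y)) \<ge> 1 - 16 / y\<^sup>2 * (\<Sum>\<^sub>\<infinity>x. lattice_majorant x)"
proof (rule has_sum_mono)
  define z where "z = Complex 0 y"
  have "(indicator {(0, 1)} has_sum (1::real)) (UNIV :: (int \<times> int) set)"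
    by (rule has_sum_finite_neutralI[of "{(0, 1)}"]) auto
  from has_sum_add[OF this has_sum_cmult_right[OF has_sum_infsum[OF summable_lattice_majorant], of "- 16 / y\<^sup>2"]]
  show "((\<lambda>x. indicator {(0, 1)} x - 16 / y\<^sup>2 * lattice_majorant x) has_sum
      (1 - 16 / y\<^sup>2 * (\<Sum>\<^sub>\<infinity>x. lattice_majorant x))) UNIV"
    by simp
  show "((\<lambda>x. Re (eis_term (Complex 0 y) x)) has_sum Re (eis (Complex 0 y))) UNIV"
    by (rule has_sum_Re[OF eis_has_sum]) (use y in simp)
  fix x :: "int \<times> int"
  obtain m n where x: "x = (m, n)" by force
  show "indicator {(0, 1)} x - 16 / y\<^sup>2 * lattice_majorant x \<le> Re (eis_term (Complex 0 y) x)"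
  proof (cases "m = 0")
    case True
    have "eis_term (Complex 0 y) x = of_real (inverse (of_int n ^ 4))"
      by (simp add: x eis_term_def True)
    then have "Re (eis_term (Complex 0 y) x) = inverse (of_int n ^ 4)" by (simp only: Re_complex_of_real)
    moreover have "indicator {(0, 1)} x \<le> inverse (real_of_int n ^ 4)"
      by (auto simp: x True indicator_def)
    moreover have "16 / y\<^sup>2 * lattice_majorant x \<ge> 0"
      using y by (simp add: x lattice_majorant_def)
    ultimately show ?thesis by linarith
  next
    case False
    let ?m = "\<bar>real_of_int m\<bar>" and ?n = "\<bar>real_of_int n\<bar>"
    let ?p = "(1 + ?m) * (1 + ?n)"
    have m: "?m \<ge> 1" using False by linarith
    have "of_int m * Complex 0 y + of_int n = Complex (of_int n) (of_int m * y)"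
      by (simp add: complex_eq_iff)
    then have N: "(norm (of_int m * Complex 0 y + of_int n))\<^sup>2 = ?n\<^sup>2 + (?m * y)\<^sup>2"
      by (simp add: cmod_power2 power_mult_distrib)
    have "?p \<le> (2 * ?m) * (1 + ?n)" using m by (intro mult_right_mono) auto
    \<comment> \<open>Only one factor \<open>y\<close> is saved here. After squaring it leaves the
      decay y^(-2), which is enough.\<close>
    then have "y * ?p \<le> y * ((2 * ?m) * (1 + ?n))" using y by (intro mult_left_mono) auto
    also have "\<dots> = 2 * ?n * (?m * y) + 2 * ?m * y" by (simp add: algebra_simps)
    also have "\<dots> \<le> (?n\<^sup>2 + (?m * y)\<^sup>2) + 3 * (?m * y)\<^sup>2"
    proof (intro add_mono)
      show "2 * ?n * (?m * y) \<le> ?n\<^sup>2 + (?m * y)\<^sup>2"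
        by (rule sum_squares_bound)
      have "?m * y \<ge> 1" using m y by (simp add: mult_ge1_I)
      then have "?m * y * 1 \<le> ?m * y * (?m * y)" by (intro mult_left_mono) auto
      then show "2 * ?m * y \<le> 3 * (?m * y)\<^sup>2" using \<open>?m * y \<ge> 1\<close>
        by (simp add: power2_eq_square)
    qed
    also have "\<dots> \<le> 4 * (norm (of_int m * Complex 0 y + of_int n))\<^sup>2"
      unfolding N by simp
    finally have "(y * ?p)\<^sup>2 \<le> (4 * (norm (of_int m * Complex 0 y + of_int n))\<^sup>2)\<^sup>2"
      using y by (intro power_mono) auto
    then have *: "y\<^sup>2 * ?p\<^sup>2 \<le> 16 * norm (of_int m * Complex 0 y + of_int n) ^ 4"
      by (simp add: power_mult_distrib flip: power_mult)
    have "norm (eis_term (Complex 0 y) x) = 1 / norm (of_int m * Complex 0 y + of_int n) ^ 4"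
      by (simp add: x eis_term_def norm_inverse norm_power divide_inverse)
    also have "\<dots> \<le> 16 / (y\<^sup>2 * ?p\<^sup>2)"
    proof -
      have "y\<^sup>2 * ?p\<^sup>2 > 0" using y by (intro mult_pos_pos zero_less_power) auto
      moreover have "1 / b \<le> 16 / a" if "a \<le> 16 * b" "a > 0" for a b :: real
        using that frac_le[of 16 16 a "16 * b"] by simp
      ultimately show ?thesis using * by blast
    qed
    also have "\<dots> = 16 / y\<^sup>2 * lattice_majorant x"
      by (simp add: x lattice_majorant_def power_mult_distrib)
    finally have "norm (eis_term (Complex 0 y) x) \<le> 16 / y\<^sup>2 * lattice_majorant x" .
    moreover have "\<bar>Re (eis_term (Complex 0 y) x)\<bar> \<le> norm (eis_term (Complex 0 y) x)"
      by (rule abs_Re_le_cmod)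
    moreover have "indicator {(0, 1)} x = (0::real)" using False by (simp add: x)
    ultimately show ?thesis by linarith
  qed
qed

lemma eis_q_expansion:
  obtains e where "e holomorphic_on ball 0 1" "\<And>z. Im z > 0 \<Longrightarrow> eis z = e (qpar z)" "e 0 \<noteq> 0"
proof -
  obtain B where B: "\<And>z. Im z > 1 \<Longrightarrow> norm (eis z) \<le> B" using bounded_eis by blast
  obtain e where e: "e holomorphic_on ball 0 1" "\<And>z. Im z > 0 \<Longrightarrow> eis z = e (qpar z)"
    using q_expansion_ex[OF holomorphic_eis eis_plus_1 B] by blast
  have "((\<lambda>z. e (qpar z)) \<longlongrightarrow> e 0) at_i_infinity"
    by (intro tendsto_compose_qpar isCont_holomorphic_on[OF e(1)]) auto
  moreover have "filterlim (Complex 0) at_i_infinity at_top"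
    unfolding filterlim_iff eventually_at_i_infinity eventually_at_top_dense
    by (metis complex.sel(2))
  ultimately have "((\<lambda>y. Re (e (qpar (Complex 0 y)))) \<longlongrightarrow> Re (e 0)) at_top"
    by (intro tendsto_Re) (rule filterlim_compose)
  moreover define C where "C = (\<Sum>\<^sub>\<infinity>x. lattice_majorant x)"
  have "((\<lambda>y. 1 - 16 / y\<^sup>2 * C) \<longlongrightarrow> 1) at_top" by real_asymp
  moreover have "eventually (\<lambda>y. 1 - 16 / y\<^sup>2 * C \<le> Re (e (qpar (Complex 0 y)))) at_top"
    using eventually_ge_at_top[of 1]
  proof eventually_elim
    case (elim y)
    then show ?case using Re_eis_imaginary_axis[of y] e(2)[of "Complex 0 y"] by (simp add: C_def)
  qed
  ultimately have "1 \<le> Re (e 0)"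
    by (intro tendsto_le[of at_top "\<lambda>y. Re (e (qpar (Complex 0 y)))" _ "\<lambda>y. 1 - 16 / y\<^sup>2 * C"]) auto
  then have "e 0 \<noteq> 0" by auto
  with e show thesis by (rule that)
qed

section \<open>A cusp form of weight 12\<close>

text \<open>
  \<open>E(2z)\<close>, \<open>E(z/2)/16\<close> and \<open>E((z + 1)/2)/16\<close> are the Eisenstein sums over
  the three sublattices of index 2 in \<open>\<int>z + \<int>\<close>, so the product is a form for the full modular group.
\<close>

definition disc :: "complex \<Rightarrow> complex" where
  "disc z = (eis z - eis (2 * z)) * (eis z - eis (z / 2) / 16) * (eis z - eis ((z + 1) / 2) / 16)"

text \<open>Translation keeps the first factor and swaps the other two.\<close>

lemma disc_plus_1:
  assumes "Im z > 0"
  shows "disc (z + 1) = disc z"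
proof -
  have "eis (2 * (z + 1)) = eis (2 * z)"
    using eis_plus_of_int[of "2 * z" 2] assms by (simp add: algebra_simps)
  moreover have "eis ((z + 1 + 1) / 2) = eis (z / 2)"
    using eis_plus_1[of "z / 2"] assms by (simp add: add_divide_distrib add.assoc)
  ultimately show ?thesis
    using eis_plus_1[OF assms] by (simp add: disc_def mult_ac)
qed

text \<open>Inversion swaps the first two factors and keeps the third, and each of them picks up
  z^4.\<close>

lemma disc_uminus_inverse:
  assumes "Im z > 0"
  shows "disc (- 1 / z) = z ^ 12 * disc z"
proof -
  have z: "z \<noteq> 0" using assms by auto
  have "2 * (- 1 / z) = - 1 / (z / 2)" "- 1 / z / 2 = - 1 / (2 * z)" using z by simp_all
  then have 1: "eis (2 * (- 1 / z)) = z ^ 4 * eis (z / 2) / 16"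
    and 2: "eis (- 1 / z / 2) = 16 * z ^ 4 * eis (2 * z)"
    using eis_uminus_inverse[of "z / 2"] eis_uminus_inverse[of "2 * z"] assms
    by (simp_all only: power_divide power_mult_distrib) simp_all
  \<comment> \<open>The matrix (1, -1; 2, -1) realises the inversion in the variable (z + 1)/2; its
    denominator is z.\<close>
  have "(- 1 / z + 1) / 2 = (of_int 1 * ((z + 1) / 2) + of_int (- 1)) / (of_int 2 * ((z + 1) / 2) + of_int (- 1))"
    using z by (simp add: field_simps)
  also have "eis \<dots> = (of_int 2 * ((z + 1) / 2) + of_int (- 1)) ^ 4 * eis ((z + 1) / 2)"
    by (rule eis_moebius) (use assms in auto)
  also have "of_int 2 * ((z + 1) / 2) + of_int (- 1) = z" by (simp add: field_simps)
  finally have 3: "eis ((- 1 / z + 1) / 2) = z ^ 4 * eis ((z + 1) / 2)" .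
  have "disc (- 1 / z) = (z ^ 4 * eis z - z ^ 4 * eis (z / 2) / 16) * (z ^ 4 * eis z - z ^ 4 * eis (2 * z)) *
      (z ^ 4 * eis z - z ^ 4 * eis ((z + 1) / 2) / 16)"
    unfolding disc_def 1 2 3 eis_uminus_inverse[OF assms] by simp
  also have "\<dots> = (z ^ 4 * (eis z - eis (z / 2) / 16)) * (z ^ 4 * (eis z - eis (2 * z))) *
      (z ^ 4 * (eis z - eis ((z + 1) / 2) / 16))"
    by (simp only: right_diff_distrib times_divide_eq_right)
  also have "\<dots> = (z ^ 4 * z ^ 4 * z ^ 4) * disc z"
    by (simp only: disc_def mult_ac)
  also have "z ^ 4 * z ^ 4 * z ^ 4 = z ^ 12"
    by (simp flip: power_add)
  finally show ?thesis .
qed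

lemma holomorphic_on_eis_compose [holomorphic_intros]:
  assumes "f holomorphic_on A" "\<And>z. z \<in> A \<Longrightarrow> Im (f z) > 0"
  shows "(\<lambda>z. eis (f z)) holomorphic_on A"
  using holomorphic_on_compose_gen[OF assms(1) holomorphic_eis] assms(2)
  by (simp add: o_def image_subset_iff)

lemma holomorphic_disc: "disc holomorphic_on upper_half_plane"
  unfolding disc_def by (intro holomorphic_intros) auto

text \<open>The constant term of \<open>eis\<close>, classically 2 zeta(4). As a limit it passes
  directly to \<open>eis (t * z + b)\<close>.\<close>

definition eis_const :: complex where
  "eis_const = (THE c. (eis \<longlongrightarrow> c) at_i_infinity)"

lemma tendsto_eis: "(eis \<longlongrightarrow> eis_const) at_i_infinity"
  and eis_const_nonzero: "eis_const \<noteq> 0"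
proof -
  have lim: "(eis \<longlongrightarrow> e 0) at_i_infinity"
    if "e holomorphic_on ball 0 1" "\<And>z. Im z > 0 \<Longrightarrow> eis z = e (qpar z)" for e
  proof -
    have "((\<lambda>z. e (qpar z)) \<longlongrightarrow> e 0) at_i_infinity"
      by (intro tendsto_compose_qpar isCont_holomorphic_on[OF that(1)]) auto
    then show ?thesis
      by (rule Lim_transform_eventually)
         (rule eventually_mono[OF eventually_upper_half_plane], simp add: that(2))
  qed
  have eq: "eis_const = c" if "(eis \<longlongrightarrow> c) at_i_infinity" for c
    unfolding eis_const_def using that tendsto_unique[OF at_i_infinity_neq_bot] by blast
  obtain e where e: "e holomorphic_on ball 0 1" "\<And>z. Im z > 0 \<Longrightarrow> eis z = e (qpar z)" "e 0 \<noteq> 0"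
    using eis_q_expansion by blast
  show "(eis \<longlongrightarrow> eis_const) at_i_infinity" "eis_const \<noteq> 0"
    using lim[OF e(1,2)] eq[OF lim[OF e(1,2)]] e(3) by simp_all
qed

lemma tendsto_eis_affine:
  "t > 0 \<Longrightarrow> ((\<lambda>z. eis (of_real t * z + b)) \<longlongrightarrow> eis_const) at_i_infinity"
  by (rule tendsto_at_i_infinity_affine[OF tendsto_eis])

text \<open>Only the first factor tends to 0; the weights 1/16 keep the constant terms of the other
  two from cancelling.\<close>

lemma tendsto_disc_factors:
  "((\<lambda>z. eis z - eis (2 * z)) \<longlongrightarrow> 0) at_i_infinity"
  "((\<lambda>z. eis z - eis (z / 2) / 16) \<longlongrightarrow> eis_const * (15 / 16)) at_i_infinity"
  "((\<lambda>z. eis z - eis ((z + 1) / 2) / 16) \<longlongrightarrow> eis_const * (15 / 16)) at_i_infinity"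
proof -
  have half: "of_real (1 / 2) * z + b = z / 2 + b" for z b :: complex by simp
  have "((\<lambda>z. eis z - eis (2 * z)) \<longlongrightarrow> eis_const - eis_const) at_i_infinity"
    using tendsto_eis_affine[of 2 0] by (intro tendsto_intros tendsto_eis) simp
  then show "((\<lambda>z. eis z - eis (2 * z)) \<longlongrightarrow> 0) at_i_infinity" by simp
  have "((\<lambda>z. eis z - eis (z / 2) / 16) \<longlongrightarrow> eis_const - eis_const / 16) at_i_infinity"
    using tendsto_eis_affine[of "1 / 2" 0] unfolding half by (intro tendsto_intros tendsto_eis) auto
  then show "((\<lambda>z. eis z - eis (z / 2) / 16) \<longlongrightarrow> eis_const * (15 / 16)) at_i_infinity"
    by (simp add: field_simps)
  have "((\<lambda>z. eis z - eis ((z + 1) / 2) / 16) \<longlongrightarrow> eis_const - eis_const / 16) at_i_infinity"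
    using tendsto_eis_affine[of "1 / 2" "1 / 2"] unfolding half
    by (intro tendsto_intros tendsto_eis) (auto simp: add_divide_distrib)
  then show "((\<lambda>z. eis z - eis ((z + 1) / 2) / 16) \<longlongrightarrow> eis_const * (15 / 16)) at_i_infinity"
    by (simp add: field_simps)
qed

lemma tendsto_disc: "(disc \<longlongrightarrow> 0) at_i_infinity"
  using tendsto_mult[OF tendsto_mult[OF tendsto_disc_factors(1,2)] tendsto_disc_factors(3)]
  by (simp add: disc_def[abs_def])

text \<open>Iterated doubling moves \<open>z\<close> to infinity, so \<open>eis\<close> would equal
  its limit, first high up and then everywhere by continuation. A nonzero constant cannot have
  weight 4.\<close>

lemma eis_eq_duplication_absurd:
  assumes "\<And>z. Im z > Y \<Longrightarrow> eis z = eis (2 * z)"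
  shows False
proof -
  define Y' where "Y' = max Y 0"
  have const: "eis z = eis_const" if "Im z > Y'" for z
  proof -
    have pos: "Im z > 0" using that by (simp add: Y'_def)
    have "eis (2 ^ n * z) = eis z" for n
    proof (induction n)
      case (Suc n)
      have "1 * Im z \<le> 2 ^ n * Im z" using pos by (intro mult_right_mono) auto
      moreover have "Im z > Y" using that by (simp add: Y'_def)
      ultimately have "Im (2 ^ n * z) > Y" by simp
      then show ?case using assms[of "2 ^ n * z"] Suc by (simp add: mult_ac)
    qed simp
    moreover have "filterlim (\<lambda>n. 2 ^ n * z) at_i_infinity sequentially"
      unfolding at_i_infinity_def filterlim_filtercomap_iff o_def
    proof -
      have "filterlim (\<lambda>n. 2 ^ n * Im z) at_top sequentially"
        using pos by real_asymp
      then show "filterlim (\<lambda>n. Im (2 ^ n * z)) at_top sequentially" by simp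
    qed
    then have "(\<lambda>n. eis (2 ^ n * z)) \<longlonglongrightarrow> eis_const" by (rule filterlim_compose[OF tendsto_eis])
    ultimately show ?thesis by (simp add: LIMSEQ_const_iff)
  qed
  have eis_const: "eis z = eis_const" if "Im z > 0" for z
  proof (rule analytic_continuation_open[of "{z. Im z > Y'}" upper_half_plane eis "\<lambda>_. eis_const"])
    show "{z. Im z > Y'} \<noteq> {}" by (auto intro!: exI[of _ "Complex 0 (Y' + 1)"])
    show "open {z. Im z > Y'}" by (rule open_halfspace_Im_gt)
  qed (use that const in \<open>auto simp: Y'_def holomorphic_eis\<close>)
  \<comment> \<open>The point 2i gives the factor 16; at the fixed point i the factor would be 1 and
    there would be no contradiction.\<close>
  have "eis (- 1 / (2 * \<i>)) = (2 * \<i>) ^ 4 * eis (2 * \<i>)"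
    by (rule eis_uminus_inverse) simp
  then have "eis_const = 16 * eis_const"
    using eis_const[of "2 * \<i>"] eis_const[of "- 1 / (2 * \<i>)"] Im_uminus_inverse_pos[of "2 * \<i>"]
    by (simp add: power_mult_distrib)
  then show False using eis_const_nonzero by simp
qed

lemma holomorphic_factor_zero_disc:
  assumes "g holomorphic_on ball 0 1" "g 0 = (0::complex)"
  obtains h where "h holomorphic_on ball 0 1" "\<And>w. norm w < 1 \<Longrightarrow> g w = w * h w"
  using Schwarz3[OF assms] by metis

text \<open>Since the last two factors have nonzero limits, vanishing of the product would force
  \<open>eis z = eis (2 * z)\<close> high up.\<close>

lemma disc_not_identically_0: "\<exists>z. Im z > 0 \<and> disc z \<noteq> 0"
proof (rule ccontr)
  assume "\<not> ?thesis"
  then have 0: "disc z = 0" if "Im z > 0" for z using that by blast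
  have nz: "eis_const * (15 / 16) \<noteq> 0" using eis_const_nonzero by simp
  have "eventually (\<lambda>z. eis z = eis (2 * z)) at_i_infinity"
    using eventually_upper_half_plane
      tendsto_imp_eventually_ne[OF tendsto_disc_factors(2) nz]
      tendsto_imp_eventually_ne[OF tendsto_disc_factors(3) nz]
  proof eventually_elim
    case (elim z)
    then show ?case using 0[of z] by (auto simp: disc_def)
  qed
  then show False unfolding eventually_at_i_infinity using eis_eq_duplication_absurd by blast
qed

text \<open>Enough for both uses of \<open>level_one_eq_0\<close>: 6 < 2 * 5.1 for weight 12 and
  order 2, and 14 < 3 * 5.1 for weight 28 and order 3.\<close>

lemma sqrt3_pi_bound: "sqrt 3 * pi > 51 / 10"
proof -
  have "sqrt 3 > 17 / 10" by (rule real_less_rsqrt) (simp add: power2_eq_square)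
  then have "sqrt 3 * pi > 17 / 10 * 3" using pi_gt3 by (intro mult_strict_mono) auto
  then show ?thesis by simp
qed

text \<open>The limit 0 gives order at least one. Order two would be too much for weight 12 and make
  \<open>disc\<close> vanish identically.\<close>

lemma disc_q_expansion:
  obtains d where "d holomorphic_on ball 0 1" "\<And>z. Im z > 0 \<Longrightarrow> disc z = qpar z * d (qpar z)" "d 0 \<noteq> 0"
proof -
  have "eventually (\<lambda>z. norm (disc z) < 1) at_i_infinity"
    using tendsto_norm[OF tendsto_disc] by (auto intro: order_tendstoD)
  then obtain Y where "\<And>z. Im z > Y \<Longrightarrow> norm (disc z) \<le> 1"
    unfolding eventually_at_i_infinity by (meson less_imp_le)
  then obtain g where g: "g holomorphic_on ball 0 1" "\<And>z. Im z > 0 \<Longrightarrow> disc z = g (qpar z)"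
    using q_expansion_ex[OF holomorphic_disc disc_plus_1] by metis
  have "((\<lambda>z. g (qpar z)) \<longlongrightarrow> g 0) at_i_infinity"
    by (intro tendsto_compose_qpar isCont_holomorphic_on[OF g(1)]) auto
  moreover have "((\<lambda>z. g (qpar z)) \<longlongrightarrow> 0) at_i_infinity"
    by (rule Lim_transform_eventually[OF tendsto_disc])
       (rule eventually_mono[OF eventually_upper_half_plane], simp add: g(2))
  ultimately have "g 0 = 0" by (rule tendsto_unique[OF at_i_infinity_neq_bot])
  with g obtain d where d: "d holomorphic_on ball 0 1" "\<And>w. norm w < 1 \<Longrightarrow> g w = w * d w"
    using holomorphic_factor_zero_disc by metis
  have disc_eq: "disc z = qpar z * d (qpar z)" if "Im z > 0" for z
    using that g(2) d(2) norm_qpar_less_1_iff by metis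
  have "d 0 \<noteq> 0"
  proof
    assume "d 0 = 0"
    then obtain d2 where d2: "d2 holomorphic_on ball 0 1" "\<And>w. norm w < 1 \<Longrightarrow> d w = w * d2 w"
      using holomorphic_factor_zero_disc[OF d(1)] by metis
    have disc_eq2: "disc z = qpar z ^ 2 * d2 (qpar z)" if "Im z > 0" for z
      using disc_eq[OF that] d2(2)[of "qpar z"] that norm_qpar_less_1_iff[of z]
      by (simp add: power2_eq_square mult_ac)
    have "disc z = 0" if "Im z > 0" for z
    proof (rule level_one_eq_0[OF holomorphic_disc disc_plus_1 _ d2(1) disc_eq2 _ _ that])
      show "disc (- 1 / z) = z ^ (2 * 6) * disc z" if "Im z > 0" for z
        using disc_uminus_inverse[OF that] by simp
      show "real 6 < sqrt 3 * pi * real 2" using sqrt3_pi_bound unfolding of_nat_numeral by linarith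
    qed simp_all
    then show False using disc_not_identically_0 by blast
  qed
  with d(1) disc_eq show thesis by (rule that)
qed

section \<open>Derivatives and the Rankin-Cohen bracket\<close>

lemma deriv_plus_1:
  assumes holo: "F holomorphic_on upper_half_plane"
    and per: "\<And>w. Im w > 0 \<Longrightarrow> F (w + 1) = F w" and "Im z > 0"
  shows "deriv F (z + 1) = deriv F z"
proof -
  have "(F has_field_derivative deriv F (z + 1)) (at (z + 1))"
    by (rule holomorphic_derivI[OF holo]) (use assms(3) in auto)
  then have "((\<lambda>w. F (w + 1)) has_field_derivative deriv F (z + 1)) (at z)"
    by (simp add: DERIV_shift)
  then have "(F has_field_derivative deriv F (z + 1)) (at z)"
    by (rule has_field_derivative_transform_within_open[of _ _ _ upper_half_plane])
       (use assms(3) per in auto)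
  then show ?thesis by (simp add: DERIV_imp_deriv)
qed

lemma deriv_uminus_inverse:
  assumes holo: "F holomorphic_on upper_half_plane"
    and inv: "\<And>w. Im w > 0 \<Longrightarrow> F (- 1 / w) = G w" and "Im z > 0"
    and G: "(G has_field_derivative G') (at z)"
  shows "deriv F (- 1 / z) = z\<^sup>2 * G'"
proof -
  have z: "z \<noteq> 0" using assms(3) by auto
  have "(F has_field_derivative deriv F (- 1 / z)) (at (- 1 / z))"
    by (rule holomorphic_derivI[OF holo]) (use Im_uminus_inverse_pos[OF assms(3)] in \<open>simp_all only: in_upper_half_plane open_upper_half_plane\<close>)
  moreover have "((\<lambda>w. - 1 / w) has_field_derivative 1 / z\<^sup>2) (at z)"
    using z by (auto intro!: derivative_eq_intros simp: power2_eq_square)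
  ultimately have "((\<lambda>w. F (- 1 / w)) has_field_derivative deriv F (- 1 / z) * (1 / z\<^sup>2)) (at z)"
    by (rule DERIV_chain2)
  then have "(G has_field_derivative deriv F (- 1 / z) * (1 / z\<^sup>2)) (at z)"
    by (rule has_field_derivative_transform_within_open[of _ _ _ upper_half_plane])
       (use assms(3) inv in \<open>simp_all only: in_upper_half_plane open_upper_half_plane\<close>)
  from DERIV_unique[OF this G] show ?thesis using z by (simp add: field_simps)
qed

text \<open>Multiplying by \<open>w - a\<close> avoids the exponent \<open>n - 1\<close>. The
  conclusion again has the shape of \<open>eq\<close>, so the rule can be iterated for second
  derivatives.\<close>

lemma has_field_derivative_factor:
  assumes F: "(F has_field_derivative F') (at w)" and u: "(u has_field_derivative u') (at w)"
    and eq: "\<And>w. w \<in> S \<Longrightarrow> F w = (w - a) ^ n * u w" and "open S" "w \<in> S" "n > 0"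
  shows "(w - a) * F' = (w - a) ^ n * (of_nat n * u w + (w - a) * u')"
proof -
  obtain m where n: "n = Suc m" using \<open>n > 0\<close> by (cases n) auto
  have "((\<lambda>w. (w - a) ^ n * u w) has_field_derivative
      (of_nat n * (w - a) ^ m * u w + (w - a) ^ n * u')) (at w)"
    by (rule derivative_eq_intros refl u)+ (simp add: n)
  then have "(F has_field_derivative (of_nat n * (w - a) ^ m * u w + (w - a) ^ n * u')) (at w)"
    by (rule has_field_derivative_transform_within_open[of _ _ _ S]) (use assms in auto)
  from DERIV_unique[OF F this] show ?thesis by (simp only: n power_Suc distrib_left mult_ac)
qed

text \<open>The second Rankin--Cohen bracket of \<^const>\<open>disc\<close> with itself, of weight 28.\<close>

definition disc_bracket :: "complex \<Rightarrow> complex" where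
  "disc_bracket z = 13 * (deriv disc z)\<^sup>2 - 12 * disc z * deriv (deriv disc) z"

lemma holomorphic_deriv_disc: "deriv disc holomorphic_on upper_half_plane"
  and holomorphic_deriv2_disc: "deriv (deriv disc) holomorphic_on upper_half_plane"
  by (intro holomorphic_deriv holomorphic_disc open_upper_half_plane)+

lemma holomorphic_disc_bracket: "disc_bracket holomorphic_on upper_half_plane"
  unfolding disc_bracket_def
  by (intro holomorphic_intros holomorphic_disc holomorphic_deriv_disc holomorphic_deriv2_disc)

lemma disc_bracket_plus_1: "Im z > 0 \<Longrightarrow> disc_bracket (z + 1) = disc_bracket z"
  by (simp add: disc_bracket_def disc_plus_1 deriv_plus_1 holomorphic_disc holomorphic_deriv_disc)

text \<open>The coefficients 13 and 12 are k + 1 and k for weight k = 12. Differentiating the factor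
  z^12 creates extra multiples of disc^2 and disc disc'; they cancel because 13 * 144 = 12 * 156 and
  13 * 24 = 12 * 26.\<close>

lemma disc_bracket_uminus_inverse:
  assumes "Im z > 0"
  shows "disc_bracket (- 1 / z) = z ^ 28 * disc_bracket z"
proof -
  note der = holomorphic_derivI[OF holomorphic_disc] holomorphic_derivI[OF holomorphic_deriv_disc]
  have 1: "deriv disc (- 1 / w) = 12 * w ^ 13 * disc w + w ^ 14 * deriv disc w" if "Im w > 0" for w
  proof -
    have "((\<lambda>z. z ^ 12 * disc z) has_field_derivative 12 * w ^ 11 * disc w + w ^ 12 * deriv disc w) (at w)"
      using that by (auto intro!: derivative_eq_intros der)
    from deriv_uminus_inverse[OF holomorphic_disc disc_uminus_inverse that this]
    show ?thesis by (simp add: algebra_simps power2_eq_square power_numeral_reduce)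
  qed
  have "((\<lambda>z. 12 * z ^ 13 * disc z + z ^ 14 * deriv disc z) has_field_derivative
      156 * z ^ 12 * disc z + 26 * z ^ 13 * deriv disc z + z ^ 14 * deriv (deriv disc) z) (at z)"
    using assms by (auto intro!: derivative_eq_intros der simp: algebra_simps)
  from deriv_uminus_inverse[OF holomorphic_deriv_disc 1 assms this]
  have 2: "deriv (deriv disc) (- 1 / z) =
      156 * z ^ 14 * disc z + 26 * z ^ 15 * deriv disc z + z ^ 16 * deriv (deriv disc) z"
    by (simp add: algebra_simps power2_eq_square power_numeral_reduce)
  show ?thesis
    unfolding disc_bracket_def disc_uminus_inverse[OF assms] 1[OF assms] 2
    by (simp add: algebra_simps power2_eq_square power_numeral_reduce)
qed

text \<open>Differentiation is 2 pi i q d/dq, so both terms of the bracket are divisible by q^2. At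
  q = 0 they leave (13 - 12) (d 0)^2, up to the square of 2 pi i.\<close>

lemma disc_bracket_q_expansion:
  assumes d: "d holomorphic_on ball 0 1" "\<And>z. Im z > 0 \<Longrightarrow> disc z = qpar z * d (qpar z)"
  obtains b where "b holomorphic_on ball 0 1" "b 0 = (2 * of_real pi * \<i>)\<^sup>2 * (d 0)\<^sup>2"
    "\<And>z. Im z > 0 \<Longrightarrow> disc_bracket z = (qpar z)\<^sup>2 * b (qpar z)"
proof -
  define \<gamma> where "\<gamma> = 2 * of_real pi * \<i>"
  define g where "g = (\<lambda>w. w * d w)"
  have g: "g holomorphic_on ball 0 1" unfolding g_def by (intro holomorphic_intros d)
  have dg: "deriv g holomorphic_on ball 0 1" by (intro holomorphic_deriv g open_ball)
  have ddg: "deriv (deriv g) holomorphic_on ball 0 1" by (intro holomorphic_deriv dg open_ball)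
  have ball: "qpar z \<in> ball 0 1" if "Im z > 0" for z
    using that norm_qpar_less_1_iff[of z] by simp
  have q: "(qpar has_field_derivative \<gamma> * qpar z) (at z)" for z
    unfolding \<gamma>_def by (rule has_field_derivative_qpar)
  have comp: "((\<lambda>z. h (qpar z)) has_field_derivative deriv h (qpar z) * (\<gamma> * qpar z)) (at z)"
    if "h holomorphic_on ball 0 1" "Im z > 0" for h z
    by (rule DERIV_chain2[OF holomorphic_derivI[OF that(1) open_ball ball[OF that(2)]] q])
  have transfer: "deriv F z = F'"
    if "\<And>z. Im z > 0 \<Longrightarrow> F z = G z" "(G has_field_derivative F') (at z)" "Im z > 0" for F G F' z
    using has_field_derivative_transform_within_open[OF that(2) open_upper_half_plane] that(1,3)
    by (intro DERIV_imp_deriv) simp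
  have 1: "deriv disc z = \<gamma> * qpar z * deriv g (qpar z)" if "Im z > 0" for z
    by (rule transfer[of _ "\<lambda>z. g (qpar z)"]) (use that d(2) comp[OF g that] in \<open>simp_all add: g_def mult_ac\<close>)
  have 2: "deriv (deriv disc) z = \<gamma>\<^sup>2 * qpar z * (deriv g (qpar z) + qpar z * deriv (deriv g) (qpar z))"
    if "Im z > 0" for z
  proof (rule transfer[OF 1 _ that])
    show "((\<lambda>z. \<gamma> * qpar z * deriv g (qpar z)) has_field_derivative
        \<gamma>\<^sup>2 * qpar z * (deriv g (qpar z) + qpar z * deriv (deriv g) (qpar z))) (at z)"
      by (rule derivative_eq_intros refl q comp[OF dg that])+ (simp add: algebra_simps power2_eq_square)
  qed
  have "(g has_field_derivative (d 0 + 0 * deriv d 0)) (at 0)"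
    unfolding g_def using holomorphic_derivI[OF d(1) open_ball, of 0] by (auto intro!: derivative_eq_intros)
  then have dg0: "deriv g 0 = d 0" by (simp add: DERIV_imp_deriv)
  define b where "b = (\<lambda>w. \<gamma>\<^sup>2 * (13 * (deriv g w)\<^sup>2 - 12 * d w * (deriv g w + w * deriv (deriv g) w)))"
  show thesis
  proof (rule that[of b])
    show "b holomorphic_on ball 0 1" unfolding b_def by (intro holomorphic_intros d dg ddg)
    show "b 0 = (2 * of_real pi * \<i>)\<^sup>2 * (d 0)\<^sup>2"
      by (simp add: b_def dg0 \<gamma>_def[symmetric] power2_eq_square)
    show "disc_bracket z = (qpar z)\<^sup>2 * b (qpar z)" if "Im z > 0" for z
      unfolding disc_bracket_def 1[OF that] 2[OF that] d(2)[OF that] b_def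
      by (simp add: algebra_simps power2_eq_square)
  qed
qed

text \<open>Both sides have weight 28 and start at q^2. The constant cancels the leading
  coefficients, so the difference has order at least 3, too much for that weight.\<close>

lemma disc_bracket_eq:
  obtains \<kappa> where "\<And>z. Im z > 0 \<Longrightarrow> disc_bracket z = \<kappa> * (disc z)\<^sup>2 * eis z"
proof -
  obtain d where d: "d holomorphic_on ball 0 1" "\<And>z. Im z > 0 \<Longrightarrow> disc z = qpar z * d (qpar z)"
    using disc_q_expansion by metis
  obtain b where b: "b holomorphic_on ball 0 1" "b 0 = (2 * of_real pi * \<i>)\<^sup>2 * (d 0)\<^sup>2"
    "\<And>z. Im z > 0 \<Longrightarrow> disc_bracket z = (qpar z)\<^sup>2 * b (qpar z)"
    using disc_bracket_q_expansion[OF d] by metis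
  obtain e where e: "e holomorphic_on ball 0 1" "\<And>z. Im z > 0 \<Longrightarrow> eis z = e (qpar z)" "e 0 \<noteq> 0"
    using eis_q_expansion by metis
  define \<kappa> where "\<kappa> = (2 * of_real pi * \<i>)\<^sup>2 / e 0"
  define X where "X = (\<lambda>z. disc_bracket z - \<kappa> * (disc z)\<^sup>2 * eis z)"
  define x where "x = (\<lambda>w. b w - \<kappa> * (d w)\<^sup>2 * e w)"
  have "x holomorphic_on ball 0 1" unfolding x_def by (intro holomorphic_intros b d e)
  moreover have "x 0 = 0" using e(3) by (simp add: x_def b(2) \<kappa>_def)
  ultimately obtain x1 where x1: "x1 holomorphic_on ball 0 1" "\<And>w. norm w < 1 \<Longrightarrow> x w = w * x1 w"
    using holomorphic_factor_zero_disc by metis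
  have X_eq: "X z = qpar z ^ 3 * x1 (qpar z)" if "Im z > 0" for z
  proof -
    have "X z = (qpar z)\<^sup>2 * x (qpar z)"
      using that b(3) d(2) e(2) by (simp add: X_def x_def power_mult_distrib algebra_simps)
    then show ?thesis using x1(2)[of "qpar z"] norm_qpar_less_1_iff[of z] that
      by (simp add: power3_eq_cube power2_eq_square)
  qed
  have "X z = 0" if "Im z > 0" for z
  proof (rule level_one_eq_0[OF _ _ _ x1(1) X_eq _ _ that])
    show "X holomorphic_on upper_half_plane" unfolding X_def
      by (intro holomorphic_intros holomorphic_disc_bracket holomorphic_disc holomorphic_eis)
    show "X (z + 1) = X z" if "Im z > 0" for z
      using that by (simp add: X_def disc_bracket_plus_1 disc_plus_1 eis_plus_1)
    show "X (- 1 / z) = z ^ (2 * 14) * X z" if "Im z > 0" for z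
      unfolding X_def disc_bracket_uminus_inverse[OF that] disc_uminus_inverse[OF that] eis_uminus_inverse[OF that]
      by (simp add: algebra_simps flip: power_add power_mult)
    show "real 14 < sqrt 3 * pi * real 3" using sqrt3_pi_bound unfolding of_nat_numeral by linarith
  qed simp_all
  then have "disc_bracket z = \<kappa> * (disc z)\<^sup>2 * eis z" if "Im z > 0" for z
    using that by (simp add: X_def)
  then show thesis by (rule that)
qed

text \<open>
  At a zero of order \<open>n\<close> of \<^const>\<open>disc\<close> the bracket has order exactly \<open>2n - 2\<close>, because
  \<open>13 n\<^sup>2 - 12 n (n - 1) = n (n + 12) \<noteq> 0\<close>, while \<open>disc\<^sup>2 eis\<close> has order at least \<open>2n\<close>.
\<close>

lemma disc_nonzero:
  assumes "Im z0 > 0"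
  shows "disc z0 \<noteq> 0"
proof
  assume zero: "disc z0 = 0"
  have nonconst: "\<not> disc constant_on upper_half_plane"
    using disc_not_identically_0 zero assms unfolding constant_on_def by (metis in_upper_half_plane)
  have "z0 \<in> upper_half_plane" using assms by simp
  obtain u r n where n: "0 < n" and r: "0 < r" and sub: "ball z0 r \<subseteq> upper_half_plane"
    and u: "u holomorphic_on ball z0 r"
    and disc_eq: "\<And>w. w \<in> ball z0 r \<Longrightarrow> disc w = (w - z0) ^ n * u w"
    and u_nz: "\<And>w. w \<in> ball z0 r \<Longrightarrow> u w \<noteq> 0"
    using holomorphic_factor_zero_nonconstant[OF holomorphic_disc open_upper_half_plane
        connected_upper_half_plane \<open>z0 \<in> upper_half_plane\<close> zero nonconst] by metis
  obtain \<kappa> where \<kappa>: "\<And>z. Im z > 0 \<Longrightarrow> disc_bracket z = \<kappa> * (disc z)\<^sup>2 * eis z"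
    using disc_bracket_eq by blast
  define N where "N = (of_nat n :: complex)"
  define A where "A = (\<lambda>w. N * u w + (w - z0) * deriv u w)"
  have du: "deriv u holomorphic_on ball z0 r" by (intro holomorphic_deriv u open_ball)
  have A: "A holomorphic_on ball z0 r" unfolding A_def by (intro holomorphic_intros u du)
  have dA: "deriv A holomorphic_on ball z0 r" by (intro holomorphic_deriv A open_ball)
  note der = holomorphic_derivI[OF holomorphic_disc] holomorphic_derivI[OF holomorphic_deriv_disc]
  have 1: "(w - z0) * deriv disc w = (w - z0) ^ n * A w" if "w \<in> ball z0 r" for w
  proof -
    have "(disc has_field_derivative deriv disc w) (at w)"
      by (rule der(1)) (use that sub in auto)
    from has_field_derivative_factor[OF this holomorphic_derivI[OF u open_ball that] disc_eq open_ball that n]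
    show ?thesis by (simp add: A_def N_def)
  qed
  have 2: "(w - z0) * (deriv disc w + (w - z0) * deriv (deriv disc) w) =
      (w - z0) ^ n * (N * A w + (w - z0) * deriv A w)" if "w \<in> ball z0 r" for w
  proof -
    have "((\<lambda>w. (w - z0) * deriv disc w) has_field_derivative
        deriv disc w + (w - z0) * deriv (deriv disc) w) (at w)"
      using that sub by (auto intro!: derivative_eq_intros der)
    from has_field_derivative_factor[OF this holomorphic_derivI[OF A open_ball that] 1 open_ball that n]
    show ?thesis by (simp add: N_def)
  qed
  \<comment> \<open>\<open>L\<close> is the difference of the two sides of the bracket identity,
    multiplied by (w - z0)^2 and divided by (w - z0)^(2n). Written with \<open>u\<close> and
    \<open>A\<close> it has no singularity at \<open>z0\<close>.\<close>
  define L where "L = (\<lambda>w. 13 * (A w)\<^sup>2 - 12 * u w * ((N - 1) * A w + (w - z0) * deriv A w)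
      - \<kappa> * (w - z0)\<^sup>2 * (u w)\<^sup>2 * eis w)"
  have "L holomorphic_on ball z0 r"
    unfolding L_def using sub by (intro holomorphic_intros A dA u) auto
  then have "(L \<longlongrightarrow> L z0) (at z0)"
    using r by (intro isContD isCont_holomorphic_on[of L "ball z0 r"]) auto
  moreover have "eventually (\<lambda>w. L w = 0) (at z0)"
    unfolding eventually_at
  proof (intro exI[of _ r] conjI ballI impI r)
    fix w assume "w \<noteq> z0 \<and> dist w z0 < r"
    then have w: "w \<in> ball z0 r" and nz: "w - z0 \<noteq> 0" by (auto simp: dist_commute)
    define v where "v = w - z0"
    have "v\<^sup>2 * disc_bracket w = 13 * (v * deriv disc w)\<^sup>2 - 12 * disc w * (v\<^sup>2 * deriv (deriv disc) w)"
      by (simp add: disc_bracket_def algebra_simps power2_eq_square)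
    also have "v\<^sup>2 * deriv (deriv disc) w = v ^ n * ((N - 1) * A w + v * deriv A w)"
      using 1[OF w] 2[OF w] by (simp add: v_def algebra_simps power2_eq_square)
    also have "v * deriv disc w = v ^ n * A w" using 1[OF w] by (simp add: v_def)
    also have "disc w = v ^ n * u w" using disc_eq[OF w] by (simp add: v_def)
    also have "13 * (v ^ n * A w)\<^sup>2 - 12 * (v ^ n * u w) * (v ^ n * ((N - 1) * A w + v * deriv A w)) =
        (v ^ n)\<^sup>2 * (13 * (A w)\<^sup>2 - 12 * u w * ((N - 1) * A w + v * deriv A w))"
      by (simp add: algebra_simps power2_eq_square)
    finally have "v\<^sup>2 * disc_bracket w =
        (v ^ n)\<^sup>2 * (13 * (A w)\<^sup>2 - 12 * u w * ((N - 1) * A w + v * deriv A w))" .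
    moreover have "v\<^sup>2 * disc_bracket w = (v ^ n)\<^sup>2 * (\<kappa> * v\<^sup>2 * (u w)\<^sup>2 * eis w)"
      using \<kappa>[of w] w sub disc_eq[OF w] by (auto simp: v_def power_mult_distrib mult_ac)
    ultimately have "(v ^ n)\<^sup>2 * L w = 0"
      by (simp add: L_def v_def right_diff_distrib)
    then show "L w = 0" using nz by (simp add: v_def)
  qed
  then have "(L \<longlongrightarrow> 0) (at z0)" by (rule tendsto_eventually)
  ultimately have "L z0 = 0" by (intro tendsto_unique[of "at z0"]) auto
  moreover have "L z0 = (u z0)\<^sup>2 * (N * (N + 12))"
    by (simp add: L_def A_def algebra_simps power2_eq_square)
  moreover have "N * (N + 12) \<noteq> 0"
  proof -
    have "N * (N + 12) = of_nat (n * (n + 12))" by (simp add: N_def)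
    then show ?thesis using n by (simp only: of_nat_eq_0_iff) simp
  qed
  ultimately show False using u_nz[of z0] r by auto
qed

lemma eis_diff_duplication_nonzero: "Im z > 0 \<Longrightarrow> eis z - eis (2 * z) \<noteq> 0"
  using disc_nonzero[of z] by (auto simp: disc_def)

text \<open>The simple zero of \<open>disc\<close> at infinity belongs entirely to this factor,
  because the other two have nonzero limits.\<close>

lemma tendsto_eis_diff_duplication:
  obtains c where "c \<noteq> 0" "((\<lambda>z. (eis z - eis (2 * z)) / qpar z) \<longlongrightarrow> c) at_i_infinity"
proof -
  obtain d where d: "d holomorphic_on ball 0 1" "\<And>z. Im z > 0 \<Longrightarrow> disc z = qpar z * d (qpar z)" "d 0 \<noteq> 0"
    using disc_q_expansion by metis
  let ?f = "\<lambda>z. (eis z - eis (z / 2) / 16) * (eis z - eis ((z + 1) / 2) / 16)"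
  let ?c = "d 0 / ((eis_const * (15 / 16)) * (eis_const * (15 / 16)))"
  have "((\<lambda>z. d (qpar z) / ?f z) \<longlongrightarrow> ?c) at_i_infinity"
    using eis_const_nonzero
    by (intro tendsto_intros tendsto_disc_factors tendsto_compose_qpar isCont_holomorphic_on[OF d(1)]) auto
  then have "((\<lambda>z. (eis z - eis (2 * z)) / qpar z) \<longlongrightarrow> ?c) at_i_infinity"
  proof (rule Lim_transform_eventually, intro eventually_mono[OF eventually_upper_half_plane])
    fix z :: complex assume z: "Im z > 0"
    then have "disc z \<noteq> 0" by (rule disc_nonzero)
    then have "?f z \<noteq> 0" by (simp add: disc_def)
    moreover have "d (qpar z) * qpar z = (eis z - eis (2 * z)) * ?f z"
      using d(2)[OF z] by (simp only: disc_def mult_ac)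
    ultimately show "d (qpar z) / ?f z = (eis z - eis (2 * z)) / qpar z"
      using frac_eq_eq qpar_nonzero by blast
  qed
  moreover have "?c \<noteq> 0" using d(3) eis_const_nonzero by simp
  ultimately show thesis by (rule that[rotated])
qed

section \<open>A weight 4 form vanishing only at infinity\<close>

lemma Im_moebius:
  fixes a b c d :: int
  assumes "a * d - b * c = 1"
  shows "Im ((of_int a * z + of_int b) / (of_int c * z + of_int d)) =
    Im z / (norm (of_int c * z + of_int d))\<^sup>2"
proof -
  have "real_of_int a * of_int d - of_int b * of_int c = 1"
    using assms by (metis of_int_1 of_int_diff of_int_mult)
  then have "Im z * (of_int a * of_int d - of_int b * of_int c) = Im z" by simp
  then have num: "Im (of_int a * z + of_int b) * Re (of_int c * z + of_int d) -
      Re (of_int a * z + of_int b) * Im (of_int c * z + of_int d) = Im z"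
    by (simp add: algebra_simps)
  show ?thesis unfolding Im_divide cmod_power2 num ..
qed

lemma Im_moebius_pos:
  fixes a b c d :: int
  assumes "a * d - b * c = 1" "Im z > 0"
  shows "Im ((of_int a * z + of_int b) / (of_int c * z + of_int d)) > 0"
  unfolding Im_moebius[OF assms(1)]
  using assms moebius_denominator_nonzero[OF assms] by simp

text \<open>A multiple of \<open>\<eta>(4z)\<^sup>1\<^sup>6 / \<eta>(2z)\<^sup>8\<close>, whose only zero on \<open>X\<^sub>0(4)\<close> is a double zero at \<open>\<infinity>\<close>.\<close>

definition theta_form :: "complex \<Rightarrow> complex" where
  "theta_form z = eis (2 * z) - eis (4 * z)"

lemma holomorphic_theta_form: "theta_form holomorphic_on upper_half_plane"
  unfolding theta_form_def by (intro holomorphic_intros) auto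

lemma theta_form_nonzero: "Im z > 0 \<Longrightarrow> theta_form z \<noteq> 0"
  using eis_diff_duplication_nonzero[of "2 * z"] by (simp add: theta_form_def)

text \<open>Passing from z to 2z or 4z divides the lower left entry by 2 or 4, which leaves integral
  matrices of determinant 1 since 4 divides \<open>c\<close>.\<close>

lemma theta_form_moebius:
  fixes a b c d :: int
  assumes det: "a * d - b * c = 1" and c: "4 dvd c" and z: "Im z > 0"
  shows "theta_form ((of_int a * z + of_int b) / (of_int c * z + of_int d)) =
    (of_int c * z + of_int d) ^ 4 * theta_form z"
proof -
  obtain c' where c': "c = 4 * c'" using c by blast
  have "2 * ((of_int a * z + of_int b) / (of_int c * z + of_int d)) =
      (of_int a * (2 * z) + of_int (2 * b)) / (of_int (2 * c') * (2 * z) + of_int d)"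
    by (simp add: c' algebra_simps)
  also have "eis \<dots> = (of_int (2 * c') * (2 * z) + of_int d) ^ 4 * eis (2 * z)"
    by (rule eis_moebius) (use det z in \<open>auto simp: c'\<close>)
  finally have 1: "eis (2 * ((of_int a * z + of_int b) / (of_int c * z + of_int d))) =
      (of_int c * z + of_int d) ^ 4 * eis (2 * z)" by (simp add: c' mult.assoc)
  have "4 * ((of_int a * z + of_int b) / (of_int c * z + of_int d)) =
      (of_int a * (4 * z) + of_int (4 * b)) / (of_int c' * (4 * z) + of_int d)"
    by (simp add: c' algebra_simps)
  also have "eis \<dots> = (of_int c' * (4 * z) + of_int d) ^ 4 * eis (4 * z)"
    by (rule eis_moebius) (use det z in \<open>auto simp: c'\<close>)
  finally have 2: "eis (4 * ((of_int a * z + of_int b) / (of_int c * z + of_int d))) =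
      (of_int c * z + of_int d) ^ 4 * eis (4 * z)" by (simp add: c' mult_ac)
  show ?thesis unfolding theta_form_def 1 2 by (simp add: algebra_simps)
qed

text \<open>Doubling z squares q and turns the simple zero of E(z) - E(2z) into a double
  one.\<close>

lemma theta_form_cusp_infinity:
  obtains c where "c \<noteq> 0" "((\<lambda>z. theta_form z / (qpar z)\<^sup>2) \<longlongrightarrow> c) at_i_infinity"
proof -
  obtain c where c: "c \<noteq> 0" "((\<lambda>z. (eis z - eis (2 * z)) / qpar z) \<longlongrightarrow> c) at_i_infinity"
    using tendsto_eis_diff_duplication by metis
  have "qpar (2 * z) = (qpar z)\<^sup>2" for z
    unfolding qpar_def by (simp add: exp_of_nat_mult[of 2, symmetric, simplified] mult_ac)
  then have "((\<lambda>z. theta_form z / (qpar z)\<^sup>2) \<longlongrightarrow> c) at_i_infinity"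
    using tendsto_at_i_infinity_affine[OF c(2), of 2 0] by (simp add: theta_form_def)
  with c(1) show thesis by (rule that)
qed

text \<open>Inversion scales the two Eisenstein series by 1/16 and 1/256, so their constant terms no
  longer cancel.\<close>

lemma theta_form_cusp_0:
  obtains c where "c \<noteq> 0" "((\<lambda>z. theta_form (- 1 / z) / z ^ 4) \<longlongrightarrow> c) at_i_infinity"
proof -
  have "((\<lambda>z. eis (z / 2) / 16 - eis (z / 4) / 256) \<longlongrightarrow> eis_const / 16 - eis_const / 256) at_i_infinity"
    using tendsto_eis_affine[of "1 / 2" 0] tendsto_eis_affine[of "1 / 4" 0]
    by (intro tendsto_intros) simp_all
  then have "((\<lambda>z. theta_form (- 1 / z) / z ^ 4) \<longlongrightarrow> eis_const / 16 - eis_const / 256) at_i_infinity"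
  proof (rule Lim_transform_eventually, intro eventually_mono[OF eventually_upper_half_plane])
    fix z :: complex assume z: "Im z > 0"
    have "2 * (- 1 / z) = - 1 / (z / 2)" "4 * (- 1 / z) = - 1 / (z / 4)" by simp_all
    then have "theta_form (- 1 / z) = (z / 2) ^ 4 * eis (z / 2) - (z / 4) ^ 4 * eis (z / 4)"
      using eis_uminus_inverse[of "z / 2"] eis_uminus_inverse[of "z / 4"] z
      by (simp only: theta_form_def) simp
    also have "\<dots> = z ^ 4 * (eis (z / 2) / 16 - eis (z / 4) / 256)"
      by (simp add: power_divide algebra_simps)
    finally show "eis (z / 2) / 16 - eis (z / 4) / 256 = theta_form (- 1 / z) / z ^ 4"
      using z by auto
  qed
  moreover have "eis_const / 16 - eis_const / 256 \<noteq> 0" using eis_const_nonzero by simp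
  ultimately show thesis by (rule that[rotated])
qed

lemma theta_form_cusp_half:
  obtains c where "c \<noteq> 0" "((\<lambda>z. theta_form (z / (2 * z + 1)) / (2 * z + 1) ^ 4) \<longlongrightarrow> c) at_i_infinity"
proof -
  have "((\<lambda>z. eis (2 * z) - eis (z + 1 / 2) / 16) \<longlongrightarrow> eis_const - eis_const / 16) at_i_infinity"
    using tendsto_eis_affine[of 2 0] tendsto_eis_affine[of 1 "1 / 2"]
    by (intro tendsto_intros) simp_all
  then have "((\<lambda>z. theta_form (z / (2 * z + 1)) / (2 * z + 1) ^ 4) \<longlongrightarrow> eis_const - eis_const / 16) at_i_infinity"
  proof (rule Lim_transform_eventually, intro eventually_mono[OF eventually_upper_half_plane])
    fix z :: complex assume z: "Im z > 0"
    have nz: "2 * z + 1 \<noteq> 0"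
    proof
      assume "2 * z + 1 = 0"
      then have "Im (2 * z + 1) = 0" by simp
      with z show False by simp
    qed
    have "2 * (z / (2 * z + 1)) = (of_int 1 * (2 * z) + of_int 0) / (of_int 1 * (2 * z) + of_int 1)"
      by simp
    also have "eis \<dots> = (of_int 1 * (2 * z) + of_int 1) ^ 4 * eis (2 * z)"
      by (rule eis_moebius) (use z in auto)
    finally have 1: "eis (2 * (z / (2 * z + 1))) = (2 * z + 1) ^ 4 * eis (2 * z)" by simp
    have "z + 1 / 2 = (2 * z + 1) / 2" by (simp add: field_simps)
    \<comment> \<open>The map z -> 4z/(2z + 1) has determinant 4; it is translation by 1/2 followed
      by the unimodular matrix (2, -1; 1, 0).\<close>
    then have "4 * (z / (2 * z + 1)) = (of_int 2 * (z + 1 / 2) + of_int (- 1)) / (of_int 1 * (z + 1 / 2) + of_int 0)"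
      using nz by (simp add: field_simps)
    also have "eis \<dots> = (of_int 1 * (z + 1 / 2) + of_int 0) ^ 4 * eis (z + 1 / 2)"
      by (rule eis_moebius) (use z in auto)
    finally have 2: "eis (4 * (z / (2 * z + 1))) = (2 * z + 1) ^ 4 / 16 * eis (z + 1 / 2)"
      unfolding \<open>z + 1 / 2 = (2 * z + 1) / 2\<close> by (simp add: power_divide)
    show "eis (2 * z) - eis (z + 1 / 2) / 16 = theta_form (z / (2 * z + 1)) / (2 * z + 1) ^ 4"
      unfolding theta_form_def 1 2 using nz by (simp add: field_simps)
  qed
  moreover have "eis_const - eis_const / 16 \<noteq> 0" using eis_const_nonzero by simp
  ultimately show thesis by (rule that[rotated])
qed

section \<open>Maximum principle for invariant functions of level 4\<close>

definition mact :: "int \<times> int \<times> int \<times> int \<Rightarrow> complex \<Rightarrow> complex" where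
  "mact = (\<lambda>(a, b, c, d) z. (of_int a * z + of_int b) / (of_int c * z + of_int d))"

text \<open>One matrix for each of the cusps infinity, 0 and 1/2. The index is six; the remaining
  cosets differ from these by a translation on the right.\<close>

definition coset_reps :: "(int \<times> int \<times> int \<times> int) set" where
  "coset_reps = {(1, 0, 0, 1), (0, - 1, 1, 0), (1, 0, 2, 1)}"

lemma SL2Z_reduction:
  assumes "Im z > 0"
  obtains a b c d w where "a * d - b * c = 1" "Im w \<ge> sqrt 3 / 2" "z = mact (a, b, c, d) w"
proof -
  define P where "P = (\<lambda>z. \<exists>a b c d w. a * d - b * c = 1 \<and> Im w \<ge> sqrt 3 / 2 \<and> z = mact (a, b, c, d) w)"
  have posI: "Im w > 0" if "Im w \<ge> sqrt 3 / 2" for w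
    using that by (rule less_le_trans[rotated]) simp
  have "P z"
    using assms
  proof (induction z rule: upper_half_plane_reduction)
    case (high z)
    then show ?case unfolding P_def mact_def
      by (intro exI[of _ 1] exI[of _ 0] exI[of _ z] conjI) auto
  next
    case (plus z)
    then obtain a b c d w where *: "a * d - b * c = 1" "Im w \<ge> sqrt 3 / 2" "z + 1 = mact (a, b, c, d) w"
      unfolding P_def by blast
    have nz: "of_int c * w + of_int d \<noteq> 0" using moebius_denominator_nonzero[OF *(1)] posI *(2) by blast
    have "z = mact (a - c, b - d, c, d) w"
      using *(3) nz by (simp add: mact_def eq_divide_eq algebra_simps)
    then show ?case unfolding P_def
      using *(1,2) by (intro exI[of _ "a - c"] exI[of _ "b - d"] exI[of _ c] exI[of _ d] exI[of _ w])
        (simp add: algebra_simps)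
  next
    case (minus z)
    then obtain a b c d w where *: "a * d - b * c = 1" "Im w \<ge> sqrt 3 / 2" "z - 1 = mact (a, b, c, d) w"
      unfolding P_def by blast
    have nz: "of_int c * w + of_int d \<noteq> 0" using moebius_denominator_nonzero[OF *(1)] posI *(2) by blast
    have "z = mact (a + c, b + d, c, d) w"
      using *(3) nz by (simp add: mact_def eq_divide_eq algebra_simps)
    then show ?case unfolding P_def
      using *(1,2) by (intro exI[of _ "a + c"] exI[of _ "b + d"] exI[of _ c] exI[of _ d] exI[of _ w])
        (simp add: algebra_simps)
  next
    case (invert z)
    then obtain a b c d w where *: "a * d - b * c = 1" "Im w \<ge> sqrt 3 / 2" "- 1 / z = mact (a, b, c, d) w"
      unfolding P_def by blast
    have "z = - 1 / mact (a, b, c, d) w" unfolding *(3)[symmetric] by simp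
    then have "z = mact (- c, - d, a, b) w" by (simp add: mact_def algebra_simps)
    then show ?case unfolding P_def
      using *(1,2) by (intro exI[of _ "- c"] exI[of _ "- d"] exI[of _ a] exI[of _ b] exI[of _ w])
        (simp add: algebra_simps)
  qed
  then show thesis unfolding P_def using that by blast
qed

locale Gamma0_4_invariant =
  fixes \<Phi> :: "complex \<Rightarrow> complex"
  assumes holo: "\<Phi> holomorphic_on upper_half_plane"
    and inv: "\<And>a b c d z. \<lbrakk>a * d - b * c = 1; 4 dvd c; Im z > 0\<rbrakk> \<Longrightarrow> \<Phi> (mact (a, b, c, d) z) = \<Phi> z"
begin

text \<open>The lower left entry modulo 4 decides the cusp: 0 gives infinity, 2 gives 1/2, odd gives
  0. In the odd case a translation is split off, which leaves the imaginary part of \<open>w\<close>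
  unchanged.\<close>

lemma coset_reduction:
  assumes "Im z > 0"
  obtains t w where "t \<in> coset_reps" "Im w \<ge> sqrt 3 / 2" "\<Phi> z = \<Phi> (mact t w)"
proof -
  obtain a b c d w where *: "a * d - b * c = 1" "Im w \<ge> sqrt 3 / 2" "z = mact (a, b, c, d) w"
    using SL2Z_reduction[OF assms] by metis
  have w: "Im w > 0" using *(2) by (rule less_le_trans[rotated]) simp
  consider "4 dvd c" | "even c" "\<not> 4 dvd c" | "odd c" by blast
  then show thesis
  proof cases
    case 1
    show thesis
      by (rule that[of "(1, 0, 0, 1)" w]) (use inv[OF *(1) 1 w] * in \<open>auto simp: coset_reps_def mact_def\<close>)
  next
    case 2
    have "odd d" using *(1) 2(1) by (metis dvd_diff_commute dvd_mult dvd_mult2 even_mult_iff odd_one dvd_diff)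
    \<comment> \<open>Multiplying on the right by the inverse of (1, 0; 2, 1) replaces
      \<open>c\<close> by \<open>c - 2 * d\<close>.\<close>
    then have dvd: "4 dvd c - 2 * d" using 2 by presburger
    define u where "u = mact (1, 0, 2, 1) w"
    have u: "Im u > 0" unfolding u_def mact_def prod.case by (rule Im_moebius_pos) (use w in auto)
    have nz: "2 * w + 1 \<noteq> 0" using moebius_denominator_nonzero[of 1 1 0 2 w] w by simp
    have "mact (a - 2 * b, b, c - 2 * d, d) u =
        (((of_int a - 2 * of_int b) * w + of_int b * (2 * w + 1)) / (2 * w + 1)) /
        (((of_int c - 2 * of_int d) * w + of_int d * (2 * w + 1)) / (2 * w + 1))"
      using nz by (simp add: mact_def u_def add_divide_distrib)
    also have "(of_int a - 2 * of_int b) * w + of_int b * (2 * w + 1) = of_int a * w + of_int b"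
      by (simp add: algebra_simps)
    also have "(of_int c - 2 * of_int d) * w + of_int d * (2 * w + 1) = of_int c * w + of_int d"
      by (simp add: algebra_simps)
    also have "(of_int a * w + of_int b) / (2 * w + 1) / ((of_int c * w + of_int d) / (2 * w + 1)) = z"
      using nz unfolding *(3) mact_def by simp
    finally have "\<Phi> z = \<Phi> u"
      using inv[of "a - 2 * b" d b "c - 2 * d" u] dvd u *(1) by (simp add: algebra_simps)
    then show thesis
      by (intro that[of "(1, 0, 2, 1)" w] *(2)) (simp_all add: coset_reps_def u_def)
  next
    case 3
    \<comment> \<open>With this translation \<open>d - j * c\<close> equals d (1 - c^2), which 4
      divides as \<open>c\<close> is odd. After inversion it becomes, up to sign, the lower left
      entry.\<close>
    define j where "j = c * d"
    have "4 dvd 1 - c * c"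
    proof -
      obtain i where "c = 2 * i + 1" using 3 by (elim oddE)
      then have "1 - c * c = 4 * (- i * i - i)" by (simp add: algebra_simps)
      then show ?thesis by (metis dvd_triv_left)
    qed
    then have "4 dvd (1 - c * c) * d" by (rule dvd_mult2)
    also have "(1 - c * c) * d = d - j * c" by (simp add: j_def algebra_simps)
    finally have dvd: "4 dvd - (d - j * c)" by (simp only: dvd_minus_iff)
    define v where "v = w + of_int j"
    have "Im v = Im w" by (simp add: v_def)
    with w have v: "Im v = Im w" "v \<noteq> 0" by auto
    define u where "u = mact (0, - 1, 1, 0) v"
    have u: "Im u > 0" unfolding u_def mact_def prod.case by (rule Im_moebius_pos) (use w v in auto)
    have "mact (- (b - j * a), a, - (d - j * c), c) u =
      ((of_int a * v + of_int (b - j * a)) / v) / ((of_int c * v + of_int (d - j * c)) / v)"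
      using v by (simp add: mact_def u_def field_simps)
    also have "of_int a * v + of_int (b - j * a) = of_int a * w + of_int b"
      by (simp add: v_def algebra_simps)
    also have "of_int c * v + of_int (d - j * c) = of_int c * w + of_int d"
      by (simp add: v_def algebra_simps)
    also have "(of_int a * w + of_int b) / v / ((of_int c * w + of_int d) / v) = z"
      using v unfolding *(3) mact_def by simp
    finally have "\<Phi> z = \<Phi> u"
      using inv[OF _ dvd u, of "- (b - j * a)" c a] *(1) by (simp add: algebra_simps)
    moreover have "Im v \<ge> sqrt 3 / 2" using *(2) v(1) by (simp only:)
    ultimately show thesis
      by (intro that[of "(0, - 1, 1, 0)" v]) (simp_all only: u_def, simp add: coset_reps_def)
  qed
qed

text \<open>For \<open>A \<in> SL\<^sub>2(\<int>)\<close>, the matrix \<open>A T\<^sup>4 A\<^sup>-\<^sup>1\<close> lies in \<open>\<Gamma>(4)\<close>, so \<open>\<Phi> \<circ> A\<close> has period 4.\<close>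

lemma cusp_expansion:
  assumes det: "a * d - b * c = 1"
    and bdd: "\<And>z. Im z > Y \<Longrightarrow> norm (\<Phi> (mact (a, b, c, d) z)) \<le> B"
  obtains g where "g holomorphic_on ball 0 1"
    "\<And>z. Im z > 0 \<Longrightarrow> \<Phi> (mact (a, b, c, d) (4 * z)) = g (qpar z)"
proof -
  let ?u = "\<lambda>z. \<Phi> (mact (a, b, c, d) (4 * z))"
  have nz: "of_int c * z + of_int d \<noteq> 0" if "Im z > 0" for z
    by (rule moebius_denominator_nonzero[OF det that])
  have pos: "Im (mact (a, b, c, d) z) > 0" if "Im z > 0" for z
    unfolding mact_def prod.case by (rule Im_moebius_pos[OF det that])
  have "?u holomorphic_on upper_half_plane"
  proof -
    have "(\<lambda>z. mact (a, b, c, d) (4 * z)) holomorphic_on upper_half_plane"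
      unfolding mact_def prod.case using nz by (intro holomorphic_intros) auto
    from holomorphic_on_compose_gen[OF this holo] show ?thesis
      using pos by (auto simp: o_def image_subset_iff)
  qed
  moreover have "?u (z + 1) = ?u z" if "Im z > 0" for z
  proof -
    define w where "w = 4 * z"
    have w: "Im w > 0" "Im (w + 4) > 0" using that by (auto simp: w_def)
    let ?j = "of_int c * w + of_int d" and ?n = "of_int a * w + of_int b"
    have det': "of_int a * of_int d - of_int b * of_int c = (1 :: complex)"
      using det by (metis of_int_1 of_int_diff of_int_mult)
    \<comment> \<open>The determinant is inserted as a factor 1, so that the entries of A T^4 A^(-1)
      appear as coefficients of \<open>?n\<close> and \<open>?j\<close>.\<close>
    have num: "?n + 4 * of_int a * (of_int a * of_int d - of_int b * of_int c) =
        (1 - 4 * of_int a * of_int c) * ?n + 4 * (of_int a)\<^sup>2 * ?j"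
      by (simp add: algebra_simps power2_eq_square)
    have den: "?j + 4 * of_int c * (of_int a * of_int d - of_int b * of_int c) =
        - 4 * (of_int c)\<^sup>2 * ?n + (1 + 4 * of_int a * of_int c) * ?j"
      by (simp add: algebra_simps power2_eq_square)
    have "mact (a, b, c, d) (w + 4) = (?n + 4 * of_int a * 1) / (?j + 4 * of_int c * 1)"
      by (simp add: mact_def algebra_simps)
    also have "\<dots> = ((?n + 4 * of_int a * 1) / ?j) / ((?j + 4 * of_int c * 1) / ?j)"
      using nz[OF w(1)] by simp
    also have "\<dots> = (((1 - 4 * of_int a * of_int c) * ?n + 4 * (of_int a)\<^sup>2 * ?j) / ?j) /
        ((- 4 * (of_int c)\<^sup>2 * ?n + (1 + 4 * of_int a * of_int c) * ?j) / ?j)"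
      using num den unfolding det' by (simp only:)
    also have "\<dots> = mact (1 - 4 * a * c, 4 * a\<^sup>2, - 4 * c\<^sup>2, 1 + 4 * a * c) (mact (a, b, c, d) w)"
    proof -
      have "(\<alpha> * x + \<beta> * y) / y = \<alpha> * (x / y) + \<beta>" if "y \<noteq> 0" for \<alpha> \<beta> x y :: complex
        using that by (simp add: add_divide_distrib)
      from this[OF nz[OF w(1)]] show ?thesis by (simp only: mact_def prod.case) simp
    qed
    finally have "\<Phi> (mact (a, b, c, d) (w + 4)) = \<Phi> (mact (a, b, c, d) w)"
      using inv[of "1 - 4 * a * c" "1 + 4 * a * c" "4 * a\<^sup>2" "- 4 * c\<^sup>2" "mact (a, b, c, d) w"] pos[OF w(1)]
      by (simp add: algebra_simps power2_eq_square)
    then show ?thesis by (simp add: w_def algebra_simps)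
  qed
  moreover have "norm (?u z) \<le> B" if "Im z > Y / 4" for z
    using that by (intro bdd) simp
  ultimately show thesis using q_expansion_ex[of ?u "Y / 4" B] that by blast
qed

text \<open>By the reduction, the maximum of the three cusp expansions over small closed discs
  bounds the function everywhere. It is attained inside the unit disc, possibly at the cusp itself,
  so the maximum modulus principle makes the function constant, and the limit fixes the
  constant.\<close>

lemma vanishes:
  assumes bdd: "\<And>t. t \<in> coset_reps \<Longrightarrow> \<exists>B. eventually (\<lambda>z. norm (\<Phi> (mact t z)) \<le> B) at_i_infinity"
    and lim: "(\<Phi> \<longlongrightarrow> 0) at_i_infinity" and "Im z > 0"
  shows "\<Phi> z = 0"
proof -
  have "\<exists>g. g holomorphic_on ball 0 1 \<and> (\<forall>z. Im z > 0 \<longrightarrow> \<Phi> (mact t (4 * z)) = g (qpar z))"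
    if t: "t \<in> coset_reps" for t
  proof -
    obtain a b c d where abcd: "t = (a, b, c, d)" by (cases t)
    obtain B Y where "\<And>z. Im z > Y \<Longrightarrow> norm (\<Phi> (mact t z)) \<le> B"
      using bdd[OF t] unfolding eventually_at_i_infinity by blast
    moreover have "a * d - b * c = 1" using t abcd by (auto simp: coset_reps_def)
    ultimately show ?thesis using cusp_expansion[of a d b c Y B] unfolding abcd by metis
  qed
  then obtain g where g: "\<And>t. t \<in> coset_reps \<Longrightarrow> g t holomorphic_on ball 0 1"
    and g_eq: "\<And>t z. t \<in> coset_reps \<Longrightarrow> Im z > 0 \<Longrightarrow> \<Phi> (mact t (4 * z)) = g t (qpar z)"
    by metis
  \<comment> \<open>The modulus of \<open>qpar (w / 4)\<close> for Im w = sqrt 3 / 2, the height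
    guaranteed by \<open>coset_reduction\<close>.\<close>
  define r where "r = exp (- 2 * pi * (sqrt 3 / 8))"
  have r: "0 < r" "r < 1" by (auto simp: r_def)
  have "\<exists>q\<in>cball 0 r. \<forall>w\<in>cball 0 r. norm (g t w) \<le> norm (g t q)" if "t \<in> coset_reps" for t
  proof (rule continuous_attains_sup)
    show "continuous_on (cball 0 r) (\<lambda>w. norm (g t w))"
      by (intro continuous_intros holomorphic_on_imp_continuous_on holomorphic_on_subset[OF g[OF that]])
         (use r in auto)
  qed (use r in auto)
  then obtain q where q: "\<And>t. t \<in> coset_reps \<Longrightarrow> q t \<in> cball 0 r"
    and q_max: "\<And>t w. t \<in> coset_reps \<Longrightarrow> w \<in> cball 0 r \<Longrightarrow> norm (g t w) \<le> norm (g t (q t))"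
    by metis
  define M where "M = Max ((\<lambda>t. norm (g t (q t))) ` coset_reps)"
  have fin: "finite coset_reps" "coset_reps \<noteq> {}" by (auto simp: coset_reps_def)
  have "M \<in> (\<lambda>t. norm (g t (q t))) ` coset_reps" unfolding M_def using fin by (intro Max_in) auto
  then obtain t where t: "t \<in> coset_reps" and M: "M = norm (g t (q t))" by blast
  have M_ge: "norm (g s (q s)) \<le> M" if "s \<in> coset_reps" for s
    unfolding M_def using fin that by (intro Max_ge) auto
  have \<Phi>_le: "norm (\<Phi> z) \<le> M" if z: "Im z > 0" for z
  proof -
    obtain s w where s: "s \<in> coset_reps" "Im w \<ge> sqrt 3 / 2" "\<Phi> z = \<Phi> (mact s w)"
      using coset_reduction[OF z] by metis
    have w: "Im (w / 4) \<ge> sqrt 3 / 8" using s(2) by simp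
    then have "Im (w / 4) > 0" by (rule less_le_trans[rotated]) simp
    from g_eq[OF s(1) this] have "\<Phi> z = g s (qpar (w / 4))" using s(3) by simp
    moreover have "qpar (w / 4) \<in> cball 0 r" using w by (simp add: norm_qpar r_def)
    ultimately have "norm (\<Phi> z) \<le> norm (g s (q s))" using q_max[OF s(1)] by simp
    then show ?thesis using M_ge[OF s(1)] by linarith
  qed
  obtain a b c d where abcd: "t = (a, b, c, d)" by (cases t)
  have det: "a * d - b * c = 1" using t abcd by (auto simp: coset_reps_def)
  have g_le: "norm (g t w) \<le> norm (g t (q t))" if "w \<in> ball 0 1" for w
  proof (cases "w = 0")
    case True
    then show ?thesis using q_max[OF t, of 0] r by simp
  next
    case False
    moreover have "norm w < 1" using that by simp
    ultimately obtain y where y: "Im y > 0" "qpar y = w" using qpar_surj_disc by blast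
    have "Im (mact t (4 * y)) > 0" unfolding abcd mact_def prod.case
      by (rule Im_moebius_pos[OF det]) (use y in simp)
    then show ?thesis using \<Phi>_le[of "mact t (4 * y)"] g_eq[OF t y(1)] y(2) M by simp
  qed
  have "q t \<in> ball 0 1" using q[OF t] r by auto
  then have "g t constant_on ball 0 1"
    by (intro maximum_modulus_principle[OF g[OF t], of "ball 0 1" "q t"] g_le) auto
  then obtain C where C: "\<And>w. w \<in> ball 0 1 \<Longrightarrow> g t w = C" unfolding constant_on_def by blast
  have \<Phi>_const: "\<Phi> y = C" if "Im y > 0" for y
  proof -
    define x where "x = (of_int d * y + of_int (- b)) / (of_int (- c) * y + of_int a)"
    have det2: "d * a - (- b) * (- c) = 1" using det by (simp add: mult.commute)
    have x: "Im x > 0" unfolding x_def by (rule Im_moebius_pos[OF det2 that])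
    have nz: "of_int (- c) * y + of_int a \<noteq> 0" by (rule moebius_denominator_nonzero[OF det2 that])
    have det': "of_int a * of_int d - of_int b * of_int c = (1 :: complex)"
      using det by (metis of_int_1 of_int_diff of_int_mult)
    let ?m = "of_int (- c) * y + of_int a"
    have "of_int a * x + of_int b = (y * (of_int a * of_int d - of_int b * of_int c)) / ?m"
      using nz by (simp add: x_def field_simps)
    moreover have "of_int c * x + of_int d = (of_int a * of_int d - of_int b * of_int c) / ?m"
      using nz by (simp add: x_def field_simps)
    ultimately have "mact t x = y" using nz unfolding det' by (simp add: abcd mact_def)
    moreover have "qpar (x / 4) \<in> ball 0 1" using x norm_qpar_less_1_iff[of "x / 4"] by simp
    ultimately show ?thesis using g_eq[OF t, of "x / 4"] x C by simp
  qed
  have "(\<Phi> \<longlongrightarrow> C) at_i_infinity"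
    by (rule tendsto_eventually) (rule eventually_mono[OF eventually_upper_half_plane \<Phi>_const])
  then have "C = 0" by (rule tendsto_unique[OF at_i_infinity_neq_bot _ lim])
  then show ?thesis using \<Phi>_const assms(3) by simp
qed

end

section \<open>Forms of small weight and high order at infinity\<close>

lemma tendsto_imp_eventually_norm_le:
  assumes "(f \<longlongrightarrow> L) F"
  shows "eventually (\<lambda>x. norm (f x) \<le> norm L + 1) F"
  using order_tendstoD(2)[OF tendsto_norm[OF assms], of "norm L + 1"]
  by (auto elim: eventually_mono)

text \<open>The cusp conditions are bounds rather than expansions, which makes them easy to verify
  for a translate. They are taken along the matrices of \<open>coset_reps\<close>, and the last one
  encodes order at least \<open>l + 1\<close> at infinity.\<close>

locale Gamma0_4_form =
  fixes l :: int and h :: "complex \<Rightarrow> complex"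
  assumes holo: "h holomorphic_on upper_half_plane"
    and modular: "\<And>a b c d z. \<lbrakk>a * d - b * c = 1; 4 dvd c; Im z > 0\<rbrakk> \<Longrightarrow>
      h (mact (a, b, c, d) z) = (of_int c * z + of_int d) powi (2 * l) * h z"
    and cusp_0: "\<exists>B. eventually (\<lambda>z. norm (z powi (- (2 * l)) * h (- 1 / z)) \<le> B) at_i_infinity"
    and cusp_half: "\<exists>B. eventually (\<lambda>z. norm ((2 * z + 1) powi (- (2 * l)) * h (z / (2 * z + 1))) \<le> B) at_i_infinity"
    and cusp_infinity: "\<exists>B. eventually (\<lambda>z. norm (h z) \<le> B * norm (qpar z powi (l + 1))) at_i_infinity"
begin

text \<open>Squaring makes the weights agree, 4l above and below, for odd \<open>l\<close> too;
  \<open>powi\<close> covers negative \<open>l\<close>.\<close>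

definition quotient :: "complex \<Rightarrow> complex" where
  "quotient z = (h z)\<^sup>2 / theta_form z powi l"

text \<open>\<open>R\<close> is the map of a coset representative and \<open>j\<close> its
  denominator. The automorphy factors of \<open>h\<close>^2 and of the power of
  \<open>theta_form\<close> cancel, and the nonzero limit \<open>c\<close> keeps the denominator
  harmless for either sign of \<open>l\<close>.\<close>

lemma quotient_bounded_at_cusp:
  assumes lim: "((\<lambda>z. theta_form (R z) / j z ^ 4) \<longlongrightarrow> c) at_i_infinity" and "c \<noteq> 0"
    and bdd: "\<exists>B. eventually (\<lambda>z. norm (j z powi (- (2 * l)) * h (R z)) \<le> B) at_i_infinity"
    and nz: "\<And>z. Im z > 0 \<Longrightarrow> j z \<noteq> 0"
  shows "\<exists>B. eventually (\<lambda>z. norm (quotient (R z)) \<le> B) at_i_infinity"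
proof -
  obtain B where B: "eventually (\<lambda>z. norm (j z powi (- (2 * l)) * h (R z)) \<le> B) at_i_infinity"
    using bdd by blast
  let ?g = "\<lambda>z. inverse ((theta_form (R z) / j z ^ 4) powi l)"
  have "(?g \<longlongrightarrow> inverse (c powi l)) at_i_infinity"
    using \<open>c \<noteq> 0\<close> by (intro tendsto_intros lim) auto
  then obtain C where C: "eventually (\<lambda>z. norm (?g z) \<le> C) at_i_infinity"
    using tendsto_imp_eventually_norm_le by blast
  have "eventually (\<lambda>z. norm (quotient (R z)) \<le> B\<^sup>2 * C) at_i_infinity"
    using B C eventually_upper_half_plane
  proof eventually_elim
    case (elim z)
    let ?u = "j z powi (- (2 * l)) * h (R z)"
    have "?u\<^sup>2 * ?g z = quotient (R z)"
    proof -
      have "(j z powi (- (2 * l)))\<^sup>2 = inverse ((j z ^ 4) powi l)"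
        by (simp add: power_int_minus power_inverse power_int_power power_int_power' mult_ac)
      moreover have "j z ^ 4 \<noteq> 0" using nz elim by simp
      ultimately show ?thesis
        by (simp add: quotient_def power_mult_distrib divide_inverse power_int_mult_distrib power_int_inverse)
    qed
    then have "norm (quotient (R z)) = (norm ?u)\<^sup>2 * norm (?g z)"
      by (metis norm_mult norm_power)
    also have "\<dots> \<le> B\<^sup>2 * C"
      using elim by (intro mult_mono power_mono) auto
    finally show ?case .
  qed
  then show ?thesis by blast
qed

text \<open>The order at infinity is at least 2(l + 1) - 2l = 2, and the surplus q^2 gives the
  limit.\<close>

lemma tendsto_quotient: "(quotient \<longlongrightarrow> 0) at_i_infinity"
proof -
  obtain B where B: "eventually (\<lambda>z. norm (h z) \<le> B * norm (qpar z powi (l + 1))) at_i_infinity"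
    using cusp_infinity by blast
  obtain c where c: "c \<noteq> 0" "((\<lambda>z. theta_form z / (qpar z)\<^sup>2) \<longlongrightarrow> c) at_i_infinity"
    using theta_form_cusp_infinity by metis
  let ?g = "\<lambda>z. inverse ((theta_form z / (qpar z)\<^sup>2) powi l)"
  show ?thesis
  proof (rule Lim_null_comparison)
    show "eventually (\<lambda>z. norm (quotient z) \<le> B\<^sup>2 * norm ((qpar z)\<^sup>2 * ?g z)) at_i_infinity"
      using B
    proof eventually_elim
      case (elim z)
      have pow: "(qpar z powi (l + 1))\<^sup>2 = (qpar z)\<^sup>2 * ((qpar z)\<^sup>2) powi l"
        by (simp add: power_int_add power_mult_distrib power_int_power power_int_power' mult_ac)
      have "norm (quotient z) = (norm (h z))\<^sup>2 * norm (inverse (theta_form z powi l))"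
        by (simp add: quotient_def norm_mult norm_power norm_divide divide_inverse norm_inverse)
      also have "\<dots> \<le> (B * norm (qpar z powi (l + 1)))\<^sup>2 * norm (inverse (theta_form z powi l))"
        using elim by (intro mult_right_mono power_mono) auto
      also have "\<dots> = B\<^sup>2 * norm ((qpar z powi (l + 1))\<^sup>2 * inverse (theta_form z powi l))"
        by (simp add: power_mult_distrib norm_mult norm_power)
      also have "(qpar z powi (l + 1))\<^sup>2 * inverse (theta_form z powi l) = (qpar z)\<^sup>2 * ?g z"
        unfolding pow by (simp add: divide_inverse power_int_mult_distrib power_int_inverse)
      finally show ?case .
    qed
    have "((\<lambda>z. B\<^sup>2 * norm ((qpar z)\<^sup>2 * ?g z)) \<longlongrightarrow> B\<^sup>2 * norm (0\<^sup>2 * inverse (c powi l))) at_i_infinity"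
      using c by (intro tendsto_intros tendsto_qpar_0) auto
    then show "((\<lambda>z. B\<^sup>2 * norm ((qpar z)\<^sup>2 * ?g z)) \<longlongrightarrow> 0) at_i_infinity" by simp
  qed
qed

sublocale quotient: Gamma0_4_invariant quotient
proof
  show "quotient holomorphic_on upper_half_plane"
    unfolding quotient_def using theta_form_nonzero
    by (intro holomorphic_intros holo holomorphic_theta_form) auto
next
  fix a b c d :: int and z :: complex
  assume A: "a * d - b * c = 1" "4 dvd c" "Im z > 0"
  let ?j = "of_int c * z + of_int d"
  have j: "?j \<noteq> 0" by (rule moebius_denominator_nonzero[OF A(1,3)])
  have "theta_form (mact (a, b, c, d) z) = ?j ^ 4 * theta_form z"
    unfolding mact_def prod.case by (rule theta_form_moebius[OF A])
  moreover have "(?j powi (2 * l))\<^sup>2 = (?j ^ 4) powi l"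
    by (simp add: power_int_power power_int_power' mult_ac)
  ultimately show "quotient (mact (a, b, c, d) z) = quotient z"
    using j by (simp add: quotient_def modular[OF A] power_mult_distrib power_int_mult_distrib)
qed

theorem form_eq_0:
  assumes "Im z > 0"
  shows "h z = 0"
proof -
  have "quotient z = 0"
  proof (rule quotient.vanishes[OF _ tendsto_quotient assms])
    fix t assume "t \<in> coset_reps"
    then consider "t = (1, 0, 0, 1)" | "t = (0, - 1, 1, 0)" | "t = (1, 0, 2, 1)"
      unfolding coset_reps_def by blast
    then show "\<exists>B. eventually (\<lambda>z. norm (quotient (mact t z)) \<le> B) at_i_infinity"
    proof cases
      case 1
      then show ?thesis using tendsto_imp_eventually_norm_le[OF tendsto_quotient]
        by (auto simp: mact_def)
    next
      case 2
      obtain c where "c \<noteq> 0" "((\<lambda>z. theta_form (- 1 / z) / z ^ 4) \<longlongrightarrow> c) at_i_infinity"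
        using theta_form_cusp_0 by metis
      from quotient_bounded_at_cusp[OF this(2,1) cusp_0] show ?thesis
        by (force simp: 2 mact_def)
    next
      case 3
      obtain c where c: "c \<noteq> 0" "((\<lambda>z. theta_form (z / (2 * z + 1)) / (2 * z + 1) ^ 4) \<longlongrightarrow> c) at_i_infinity"
        using theta_form_cusp_half by metis
      have "2 * z + 1 \<noteq> 0" if "Im z > 0" for z
        using moebius_denominator_nonzero[of 1 1 0 2 z] that by simp
      from quotient_bounded_at_cusp[OF c(2,1) cusp_half this] show ?thesis
        by (simp add: 3 mact_def)
    qed
  qed
  then show ?thesis using theta_form_nonzero[OF assms] by (simp add: quotient_def)
qed

end

section \<open>Laurent series in q\<close>

lemma q_series_coefficient_eq_0:
  fixes b :: "int \<Rightarrow> complex"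
  assumes sum: "\<And>z. Im z > 0 \<Longrightarrow> ((\<lambda>n. b n * qpar z powi n) has_sum 0) {N..}" and "n \<ge> N"
  shows "b n = 0"
proof (rule ccontr)
  assume nz: "b n \<noteq> 0"
  \<comment> \<open>Multiplication by \<open>w powi (1 - N)\<close> leaves a power series without
    constant term. Its sum at \<open>w = 0\<close>, a point that no \<open>qpar z\<close> reaches,
    is then 0 whatever \<open>b N\<close> is.\<close>
  define c where "c = (\<lambda>j. case j of 0 \<Rightarrow> 0 | Suc i \<Rightarrow> b (N + int i))"
  have sums: "(\<lambda>j. c j * w ^ j) sums 0" if w: "norm w < 1" for w
  proof (cases "w = 0")
    case True
    have "(\<lambda>j. c j * w ^ j) = (\<lambda>_. 0)"
    proof
      show "c j * w ^ j = 0" for j using True by (cases j) (auto simp: c_def)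
    qed
    then show ?thesis by simp
  next
    case False
    then obtain z where z: "Im z > 0" "qpar z = w" using qpar_surj_disc w by blast
    have "bij_betw (\<lambda>i. N + int i) UNIV {N..}"
      by (rule bij_betwI[where g = "\<lambda>n. nat (n - N)"]) auto
    from has_sum_reindex_bij_betw[OF this, of "\<lambda>n. b n * w powi n" 0]
    have "((\<lambda>i. b (N + int i) * w powi (N + int i)) has_sum 0) UNIV"
      using sum[OF z(1)] z(2) by simp
    from has_sum_cmult_right[OF this, of "w powi (1 - N)"]
    have "((\<lambda>i. w powi (1 - N) * (b (N + int i) * w powi (N + int i))) has_sum 0) UNIV" by simp
    also have "(\<lambda>i. w powi (1 - N) * (b (N + int i) * w powi (N + int i))) = (\<lambda>i. c (Suc i) * w ^ Suc i)"
    proof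
      fix i
      have "w powi (1 - N) * w powi (N + int i) = w powi (int (Suc i))"
        using False by (simp add: power_int_add[symmetric])
      also have "\<dots> = w ^ Suc i" by (rule power_int_of_nat)
      finally show "w powi (1 - N) * (b (N + int i) * w powi (N + int i)) = c (Suc i) * w ^ Suc i"
        by (simp add: c_def mult_ac)
    qed
    finally have "((\<lambda>i. c (Suc i) * w ^ Suc i) has_sum 0) UNIV" .
    then have "(\<lambda>i. c (Suc i) * w ^ Suc i) sums 0" by (rule has_sum_imp_sums)
    then show ?thesis using sums_Suc_iff[of "\<lambda>j. c j * w ^ j" 0] by (simp add: c_def)
  qed
  have "c (Suc (nat (n - N))) \<noteq> 0" using nz \<open>n \<ge> N\<close> by (simp add: c_def)
  then obtain s :: real where s: "0 < s" "\<And>z::complex. z \<in> cball 0 s - {0} \<Longrightarrow> (0::complex) \<noteq> 0"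
    using powser_0_nonzero[of 1 0 c "\<lambda>_. 0" "Suc (nat (n - N))"] sums by auto
  show False using s(2)[of "of_real s"] s(1) by simp
qed

text \<open>For Im z > 1 the series is compared with the absolutely convergent one at i: |q| is
  smaller there, and only powers q^(n - N) with n >= N remain after q^N is split off.\<close>

lemma q_series_bound:
  fixes b :: "int \<Rightarrow> complex"
  assumes sum: "\<And>z. Im z > 0 \<Longrightarrow> ((\<lambda>n. b n * qpar z powi n) has_sum h z) {N..}"
  shows "\<exists>B. eventually (\<lambda>z. norm (h z) \<le> B * norm (qpar z powi N)) at_i_infinity"
proof -
  define r where "r = norm (qpar \<i>)"
  have r: "r > 0" by (simp add: r_def)
  define S where "S = (\<Sum>\<^sub>\<infinity>n\<in>{N..}. norm (b n * qpar \<i> powi n))"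
  have "(\<lambda>n. norm (b n * qpar \<i> powi n)) summable_on {N..}"
    using has_sum_imp_summable[OF sum[of \<i>]]
    by (intro summable_on_iff_abs_summable_on_complex[THEN iffD1]) simp
  then have S: "((\<lambda>n. norm (b n * qpar \<i> powi n)) has_sum S) {N..}"
    unfolding S_def by (rule has_sum_infsum)
  have "norm (h z) \<le> S / r powi N * norm (qpar z powi N)" if z: "Im z > 1" for z
  proof (rule norm_infsum_le[OF sum])
    show "((\<lambda>n. norm (b n * qpar \<i> powi n) * (norm (qpar z powi N) / r powi N)) has_sum
        S / r powi N * norm (qpar z powi N)) {N..}"
      using has_sum_cmult_left[OF S, of "norm (qpar z powi N) / r powi N"] by (simp add: mult_ac)
    show "norm (b n * qpar z powi n) \<le> norm (b n * qpar \<i> powi n) * (norm (qpar z powi N) / r powi N)"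
      if "n \<in> {N..}" for n
    proof -
      define x where "x = norm (qpar z)"
      have x: "x > 0" "x \<le> r" using z by (simp_all add: x_def r_def norm_qpar)
      have split: "y powi n = y powi N * y powi (n - N)" if "y > 0" for y :: real
        using that by (simp add: power_int_add[symmetric])
      have "x powi (n - N) \<le> r powi (n - N)"
        using x \<open>n \<in> {N..}\<close> by (intro power_int_mono) auto
      then have "norm (b n) * (x powi N * x powi (n - N)) \<le> norm (b n) * (x powi N * r powi (n - N))"
        using x by (intro mult_left_mono) auto
      also have "r powi (n - N) = r powi n / r powi N" using split[OF r] r by simp
      finally show ?thesis
        using split[OF x(1)] by (simp add: norm_mult norm_power_int x_def[symmetric] r_def[symmetric] mult_ac)
    qed
  qed (use z in simp)
  then show ?thesis unfolding eventually_at_i_infinity by blast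
qed

section \<open>Modularity and cusp conditions in terms of matrix entries\<close>

lemma slash_mact:
  "slash k f (vector [vector [a, b], vector [c, d]]) z =
     (of_int c * z + of_int d) powi (- k) * f (mact (a, b, c, d) z)"
  by (simp add: slash_def mact_def vector_2)

lemma mem_SL2Z: "(vector [vector [a, b], vector [c, d]] :: int ^ 2 ^ 2) \<in> SL2Z \<longleftrightarrow> a * d - b * c = 1"
  by (simp add: SL2Z_def det_2 vector_2)

lemma weakly_holomorphic_form_modular:
  assumes "f \<in> weakly_holomorphic_forms k" "a * d - b * c = 1" "4 dvd c" "Im z > 0"
  shows "f (mact (a, b, c, d) z) = (of_int c * z + of_int d) powi k * f z"
proof -
  have "(vector [vector [a, b], vector [c, d]] :: int ^ 2 ^ 2) \<in> Gamma0_4"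
    using assms by (simp add: Gamma0_4_def mem_SL2Z vector_2 cong_0_iff)
  then have "slash k f (vector [vector [a, b], vector [c, d]]) z = f z"
    using assms by (simp add: weakly_holomorphic_forms_def)
  then show ?thesis
    using moebius_denominator_nonzero[OF assms(2,4)]
    by (simp add: slash_mact power_int_minus field_simps)
qed

lemma holomorphic_at_cusp_bounded:
  assumes "holomorphic_at_cusp k f s" "a * d - b * c = 1"
    and "cusp_image (vector [vector [a, b], vector [c, d]]) = s"
  shows "\<exists>B. eventually (\<lambda>z. norm ((of_int c * z + of_int d) powi (- k) * f (mact (a, b, c, d) z)) \<le> B) at_i_infinity"
proof -
  obtain g Y where g: "g analytic_on {0}"
    and eq: "\<And>z. Im z > Y \<Longrightarrow> slash k f (vector [vector [a, b], vector [c, d]]) z = g (qpar (z / 4))"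
    using assms mem_SL2Z unfolding holomorphic_at_cusp_def by metis
  have "((\<lambda>z. g (qpar z)) \<longlongrightarrow> g 0) at_i_infinity"
    by (intro tendsto_compose_qpar analytic_at_imp_isCont g)
  from tendsto_at_i_infinity_affine[OF this, of "1 / 4" 0]
  have "((\<lambda>z. g (qpar (z / 4))) \<longlongrightarrow> g 0) at_i_infinity" by simp
  then have "eventually (\<lambda>z. norm (g (qpar (z / 4))) \<le> norm (g 0) + 1) at_i_infinity"
    by (rule tendsto_imp_eventually_norm_le)
  moreover have "eventually (\<lambda>z. Im z > Y) at_i_infinity"
    unfolding eventually_at_i_infinity by blast
  ultimately have "eventually (\<lambda>z. norm ((of_int c * z + of_int d) powi (- k) * f (mact (a, b, c, d) z)) \<le> norm (g 0) + 1) at_i_infinity"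
    by eventually_elim (simp add: eq slash_mact[symmetric])
  then show ?thesis by blast
qed

lemma has_sum_translate_half:
  assumes "((\<lambda>n. a n * qpar z powi n) has_sum S) A"
    and "((\<lambda>n. a n * qpar (z + 1 / 2) powi n) has_sum S') A"
  shows "((\<lambda>n. a n * (1 - c * (- 1) powi n) * qpar z powi n) has_sum (S - c * S')) A"
proof -
  have "qpar (z + 1 / 2) powi n = (- 1) powi n * qpar z powi n" for n
    by (simp add: qpar_plus_half power_int_mult_distrib[symmetric])
  then have "a n * qpar z powi n + (- c) * (a n * qpar (z + 1 / 2) powi n) =
      a n * (1 - c * (- 1) powi n) * qpar z powi n" for n
    by (simp add: algebra_simps)
  then show ?thesis
    using has_sum_add[OF assms(1) has_sum_cmult_right[OF assms(2), of "- c"]] by simp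
qed

text \<open>Translation by \<open>1/2\<close> normalises \<open>\<Gamma>\<^sub>0(4)\<close>, fixes \<open>\<infinity>\<close> and swaps the cusps \<open>0\<close> and \<open>1/2\<close>.\<close>

lemma Gamma0_4_form_translate_half:
  assumes f: "f \<in> M_sharp (2 * l)"
    and infinity: "\<exists>B. eventually (\<lambda>z. norm (f z - s * f (z + 1 / 2)) \<le> B * norm (qpar z powi (l + 1))) at_i_infinity"
  shows "Gamma0_4_form l (\<lambda>z. f z - s * f (z + 1 / 2))"
proof
  have wf: "f \<in> weakly_holomorphic_forms (2 * l)" and c0: "holomorphic_at_cusp (2 * l) f (Some 0)"
    and c1: "holomorphic_at_cusp (2 * l) f (Some (1 / 2))"
    using f by (auto simp: M_sharp_def)
  have holo: "f holomorphic_on upper_half_plane"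
    using wf by (simp add: weakly_holomorphic_forms_def)
  then have "(\<lambda>z. f (z + 1 / 2)) holomorphic_on upper_half_plane"
    using holomorphic_on_compose_gen[of "\<lambda>z. z + 1 / 2" upper_half_plane f upper_half_plane]
    by (simp add: o_def image_subset_iff holomorphic_intros)
  with holo show "(\<lambda>z. f z - s * f (z + 1 / 2)) holomorphic_on upper_half_plane"
    by (intro holomorphic_intros)
  show "f (mact (a, b, c, d) z) - s * f (mact (a, b, c, d) z + 1 / 2) =
      (of_int c * z + of_int d) powi (2 * l) * (f z - s * f (z + 1 / 2))"
    if det: "a * d - b * c = 1" and "4 dvd c" and z: "Im z > 0" for a b c d z
  proof -
    obtain c' where c': "c = 4 * c'" using \<open>4 dvd c\<close> by blast
    have "odd (a * d - b * c + b * c)" unfolding det using c' by simp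
    then have "odd (a * d)" by simp
    then have "even (d - a)" by simp
    then obtain e where e: "d = a + 2 * e" by (elim evenE) (simp add: algebra_simps)
    \<comment> \<open>Conjugation by the translation gives (a + c/2, b + (d - a)/2 - c/4; c, d -
      c/2). It is integral because 4 divides \<open>c\<close> and \<open>d - a\<close> is
      even.\<close>
    have det': "(a + 2 * c') * (d - 2 * c') - (b + e - c') * c = 1"
      using det by (simp add: c' e algebra_simps)
    let ?j = "of_int c * z + of_int d"
    have j: "?j \<noteq> 0" by (rule moebius_denominator_nonzero[OF det z])
    have num: "of_int (a + 2 * c') * (z + 1 / 2) + of_int (b + e - c') =
        of_int a * z + of_int b + ?j * (1 / 2)"
      by (simp add: c' e field_simps)
    have den: "of_int c * (z + 1 / 2) + of_int (d - 2 * c') = ?j"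
      by (simp add: c' field_simps)
    have "x / y + 1 / 2 = (x + y * (1 / 2)) / y" if "y \<noteq> 0" for x y :: complex
      using that by (simp add: add_divide_distrib)
    from this[OF j] have "mact (a, b, c, d) z + 1 / 2 = (of_int a * z + of_int b + ?j * (1 / 2)) / ?j"
      by (simp only: mact_def prod.case)
    also have "\<dots> = mact (a + 2 * c', b + e - c', c, d - 2 * c') (z + 1 / 2)"
      unfolding mact_def prod.case num den ..
    also have "f \<dots> = ?j powi (2 * l) * f (z + 1 / 2)"
      unfolding den[symmetric]
      by (rule weakly_holomorphic_form_modular[OF wf det' \<open>4 dvd c\<close>]) (use z in simp)
    finally have "f (mact (a, b, c, d) z + 1 / 2) = ?j powi (2 * l) * f (z + 1 / 2)" .
    then show ?thesis
      using weakly_holomorphic_form_modular[OF wf det \<open>4 dvd c\<close> z] by (simp add: algebra_simps)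
  qed
  have "\<exists>B. eventually (\<lambda>z. norm ((of_int 1 * z + of_int 0) powi (- (2 * l)) * f (mact (0, - 1, 1, 0) z)) \<le> B) at_i_infinity"
    by (rule holomorphic_at_cusp_bounded[OF c0]) (simp_all add: cusp_image_def vector_2)
  then obtain B0 where B0: "eventually (\<lambda>z. norm (z powi (- (2 * l)) * f (- 1 / z)) \<le> B0) at_i_infinity"
    by (auto simp: mact_def)
  have "\<exists>B. eventually (\<lambda>z. norm ((of_int 2 * z + of_int 1) powi (- (2 * l)) * f (mact (1, 0, 2, 1) z)) \<le> B) at_i_infinity"
    by (rule holomorphic_at_cusp_bounded[OF c1]) (simp_all add: cusp_image_def vector_2)
  then obtain B1 where B1: "eventually (\<lambda>z. norm ((2 * z + 1) powi (- (2 * l)) * f (z / (2 * z + 1))) \<le> B1) at_i_infinity"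
    by (auto simp: mact_def)
  have pos: "1 / 4 > (0 :: real)" "4 > (0 :: real)" by simp_all
  have bound: "\<exists>B. eventually (\<lambda>z. norm (j z * (u z - s * v z)) \<le> B) at_i_infinity"
    if "eventually (\<lambda>z. norm (j z * u z) \<le> B) at_i_infinity"
      and "eventually (\<lambda>z. norm (j z * v z) \<le> C) at_i_infinity" for j u v B C
  proof -
    have "eventually (\<lambda>z. norm (j z * (u z - s * v z)) \<le> B + norm s * C) at_i_infinity"
      using that
    proof eventually_elim
      case (elim z)
      have "norm (j z * (u z - s * v z)) \<le> norm (j z * u z) + norm (s * (j z * v z))"
        using norm_triangle_ineq4[of "j z * u z" "s * (j z * v z)"] by (simp add: algebra_simps)
      also have "\<dots> \<le> B + norm s * C"
        unfolding norm_mult[of s] using elim by (intro add_mono mult_left_mono) auto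
      finally show ?case .
    qed
    then show ?thesis by blast
  qed
  have "eventually (\<lambda>z. norm (z powi (- (2 * l)) * f (- 1 / z + 1 / 2)) \<le> norm (2 powi (- (2 * l)) :: complex) * B1) at_i_infinity"
    using eventually_at_i_infinity_affine[OF B1 pos(1), of "- 1 / 2"] eventually_upper_half_plane
  proof eventually_elim
    case (elim z)
    \<comment> \<open>Chosen so that (1, 0; 2, 1) sends \<open>w\<close> to - 1 / z + 1 / 2: the
      condition at 1/2 for \<open>f\<close> yields the one at 0 for its translate.\<close>
    define w where "w = of_real (1 / 4) * z + (- 1 / 2)"
    have z: "z \<noteq> 0" using elim by auto
    have w: "2 * w + 1 = z / 2" by (simp add: w_def field_simps)
    have "w / (2 * w + 1) = - 1 / z + 1 / 2" unfolding w using z by (simp add: w_def field_simps)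
    moreover have "z powi (- (2 * l)) = 2 powi (- (2 * l)) * (2 * w + 1) powi (- (2 * l))"
      unfolding w power_int_mult_distrib[symmetric] by simp
    ultimately have "z powi (- (2 * l)) * f (- 1 / z + 1 / 2) =
        2 powi (- (2 * l)) * ((2 * w + 1) powi (- (2 * l)) * f (w / (2 * w + 1)))"
      by (simp only: mult.assoc)
    then show ?case
      using elim(1) unfolding w_def[symmetric] by (simp only: norm_mult mult_left_mono norm_ge_zero)
  qed
  from bound[OF B0 this]
  show "\<exists>B. eventually (\<lambda>z. norm (z powi (- (2 * l)) * (f (- 1 / z) - s * f (- 1 / z + 1 / 2))) \<le> B) at_i_infinity" .
  have "eventually (\<lambda>z. norm ((2 * z + 1) powi (- (2 * l)) * f (z / (2 * z + 1) + 1 / 2)) \<le>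
      norm ((1 / 2) powi (- (2 * l)) :: complex) * B0) at_i_infinity"
    using eventually_at_i_infinity_affine[OF B0 pos(2), of 2] eventually_upper_half_plane
  proof eventually_elim
    case (elim z)
    \<comment> \<open>From z/(2z + 1) = 1/2 - 1/(4z + 2): the translated point is 1 - 1/w, and
      period 1 of \<open>f\<close> reduces to the condition at 0.\<close>
    define w where "w = of_real 4 * z + 2"
    have "Im w > 0" using elim by (simp add: w_def)
    then have "w \<noteq> 0" by auto
    have w: "2 * z + 1 = (1 / 2) * w" by (simp add: w_def)
    have z: "z = (w - 2) / 4" by (simp add: w_def)
    have "z / (2 * z + 1) + 1 / 2 = - 1 / w + 1"
      unfolding w using \<open>w \<noteq> 0\<close> by (simp add: z field_simps)
    also have "f \<dots> = f (- 1 / w)"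
      using weakly_holomorphic_form_modular[OF wf, of 1 1 1 0 "- 1 / w"] Im_uminus_inverse_pos[OF \<open>Im w > 0\<close>]
      by (simp add: mact_def)
    finally have "(2 * z + 1) powi (- (2 * l)) * f (z / (2 * z + 1) + 1 / 2) =
        (1 / 2) powi (- (2 * l)) * (w powi (- (2 * l)) * f (- 1 / w))"
      unfolding w power_int_mult_distrib by (simp only: mult.assoc)
    then show ?case
      using elim(1) unfolding w_def[symmetric] by (simp only: norm_mult mult_left_mono norm_ge_zero)
  qed
  from bound[OF B1 this]
  show "\<exists>B. eventually (\<lambda>z. norm ((2 * z + 1) powi (- (2 * l)) * (f (z / (2 * z + 1)) - s * f (z / (2 * z + 1) + 1 / 2))) \<le> B) at_i_infinity" .
qed (rule infinity)

theorem theorem3: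
  fixes k l m n :: int and f :: "complex \<Rightarrow> complex" and a :: "int \<Rightarrow> complex"
  assumes "k = 2 * l"
    and "m \<ge> - l"
    and "n \<ge> l + 1"
    and "is_basis_form k m f a"
    and "\<not> [n = m] (mod 2)"
  shows "a n = 0"
proof -
  define s :: complex where "s = (- 1) powi m"
  define h where "h = (\<lambda>z. f z - s * f (z + 1 / 2))"
  define b where "b = (\<lambda>n. a n * (1 - s * (- 1) powi n))"
  have f: "f \<in> M_sharp (2 * l)"
    and sum: "\<And>z. Im z > 0 \<Longrightarrow> ((\<lambda>n. a n * qpar z powi n) has_sum (f z - qpar z powi (- m))) {l + 1..}"
    using assms(1,4) by (simp_all add: is_basis_form_def)
  have h_sum: "((\<lambda>n. b n * qpar z powi n) has_sum h z) {l + 1..}" if "Im z > 0" for z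
  proof -
    have "s * qpar (z + 1 / 2) powi (- m) = qpar z powi (- m)"
      by (simp add: s_def qpar_plus_half power_int_minus_left)
    then have "f z - qpar z powi (- m) - s * (f (z + 1 / 2) - qpar (z + 1 / 2) powi (- m)) = h z"
      by (simp add: h_def right_diff_distrib)
    then show ?thesis
      using has_sum_translate_half[OF sum[of z] sum[of "z + 1 / 2"], of s] that by (simp add: b_def)
  qed
  interpret Gamma0_4_form l h
    unfolding h_def
    by (rule Gamma0_4_form_translate_half[OF f]) (use q_series_bound[OF h_sum] in \<open>simp add: h_def\<close>)
  have "b n = 0"
    by (rule q_series_coefficient_eq_0[of b "l + 1"]) (use h_sum form_eq_0 assms(3) in force)+
  moreover have "s * (- 1) powi n = - 1"
    using assms(5) by (auto simp: s_def power_int_minus_left cong_def) presburger+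
  ultimately show ?thesis by (simp add: b_def)
qed

end
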